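(* Let $\mathbf{X}=(X_1,\ldots,X_N)^\intercal$ satisfy the standing assumptions (1)-(3) listed in the context, and fix a degree $\mathbf{p}=(p_1,\ldots,p_N)\in\mathbb{N}_0^N$. For any $y(\mathbf{X})\in L^2(\Omega,\mathcal{F},\mathbb{P})$, a sequence of SDD approximations $\{y_{\mathbf{p},\boldsymbol{\Xi}}(\mathbf{X})\}_{\mathbf{h}>\boldsymbol{0}}$, where $\boldsymbol{\Xi}=\{\boldsymbol{\xi}_1,\ldots,\boldsymbol{\xi}_N\}$ is a family of $(p_k+1)$-open knot sequences on $[a_k,b_k]$ and $\mathbf{h}=(h_1,\ldots,h_N)$ is the associated vector of the largest element sizes, converges to $y(\mathbf{X})$ in mean-square, i.e., \[ \lim_{\mathbf{h}\to\boldsymbol{0}}\mathbb{E}\left[\left|y(\mathbf{X})-y_{\mathbf{p},\boldsymbol{\Xi}}(\mathbf{X})\right|^2\right]=0. \] Furthermore, the sequence of SDD approximations converges in probability, that is, for any $\epsilon>0$, \[ \lim_{\mathbf{h}\to\boldsymbol{0}}\mathbb{P}\left(\left|y(\mathbf{X})-y_{\mathbf{p},\boldsymbol{\Xi}}(\mathbf{X})\right|>\epsilon\right)=0; \] and converges in distribution, that is, for all points $\xi\in\mathbb{R}$ where $F$ is continuous, \[ \lim_{\mathbf{h}\to\boldsymbol{0}}F_{\mathbf{p},\boldsymbol{\Xi}}(\xi)=F(\xi), \] where $F_{\mathbf{p},\boldsymbol{\Xi}}(\xi):=\mathbb{P}(y_{\mathbf{p},\boldsymbol{\Xi}}(\mathbf{X})\le\xi)$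 and $F(\xi):=\mathbb{P}(y(\mathbf{X})\le\xi)$ are the distribution functions of $y_{\mathbf{p},\boldsymbol{\Xi}}(\mathbf{X})$ and $y(\mathbf{X})$, respectively. If $F$ is continuous on $\mathbb{R}$, then the distribution functions converge uniformly.
   Context: Notation: $\mathbb{N}=\{1,2,\ldots\}$, $\mathbb{N}_0=\mathbb{N}\cup\{0\}$. $(\Omega,\mathcal{F},\mathbb{P})$ is a probability space with expectation $\mathbb{E}$; for $k=1,\ldots,N$ ($N\in\mathbb{N}$), $[a_k,b_k]\subset\mathbb{R}$ is a finite interval with $a_k<b_k$; $\mathbb{A}^N=\prod_{k=1}^N[a_k,b_k]$ with Borel $\sigma$-algebra $\mathcal{B}^N$; $\mathbf{X}:(\Omega,\mathcal{F})\to(\mathbb{A}^N,\mathcal{B}^N)$. Standing assumptions on $\mathbf{X}$: (1) $X_1,\ldots,X_N$ are statistically independent, not necessarily identically distributed. (2) Each $X_k$ is defined on the bounded interval $[a_k,b_k]$, hence has finite moments of all orders. (3) Each $X_k$ has an absolutely continuous marginal distribution function and a continuous marginal probability density function $f_{X_k}$ with bounded support $[a_k,b_k]$. Hence $\mathbf{X}$ has joint density $f_{\mathbf{X}}(\mathbf{x})=\prod_{k=1}^N f_{X_k}(x_k)$ supported on $\mathbb{A}^N$. For $\emptyset\neq u=\{k_1,\ldots,k_{|u|}\}\subseteq\{1,\ldots,N\}$: $\mathbf{X}_u=(X_{k_1},\ldots,X_{k_{|u|}})^\intercal$, $\mathbf{x}_u=(x_{k_1},\ldots,x_{k_{|u|}})$,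 $\mathbf{p}_u=(p_k)_{k\in u}$, $\boldsymbol{\Xi}_u=\{\boldsymbol{\xi}_k\}_{k\in u}$, $\mathbf{n}_u=(n_k)_{k\in u}$. Knots: for $n_k>p_k\ge0$, a $(p_k+1)$-open knot sequence on $[a_k,b_k]$ is a non-decreasing sequence $\boldsymbol{\xi}_k=\{\xi_{k,i}\}_{i=1}^{n_k+p_k+1}$ with distinct values $a_k=\zeta_{k,1}<\cdots<\zeta_{k,r_k}=b_k$ of multiplicities $m_{k,1}=m_{k,r_k}=p_k+1$ and $1\le m_{k,j}\le p_k+1$ for $1<j<r_k$. The largest element size in direction $k$ is $h_k=\max_{1\le j\le r_k-1}(\zeta_{k,j+1}-\zeta_{k,j})$. The limit $\mathbf{h}\to\boldsymbol{0}$ is taken with $\mathbf{p}$ fixed, along any sequence of families $\boldsymbol{\Xi}$ of such knot sequences for which $h_k\to0$ for every $k$. B-splines: $B^k_{i,0,\boldsymbol{\xi}_k}(x)=1$ if $\xi_{k,i}\le x<\xi_{k,i+1}$ and $0$ otherwise; for $p\ge1$, $B^k_{i,p,\boldsymbol{\xi}_k}(x)=\frac{x-\xi_{k,i}}{\xi_{k,i+p}-\xi_{k,i}}B^k_{i,p-1,\boldsymbol{\xi}_k}(x)+\frac{\xi_{k,i+p+1}-x}{\xi_{k,i+p+1}-\xi_{k,i+1}}B^k_{i+1,p-1,\boldsymbol{\xi}_k}(x)$, with $0/0:=0$. Orthonormalized B-splines: let $\mathbf{P}_k(x_k)=(1,B^k_{2,p_k,\boldsymbol{\xi}_k}(x_k),\ldots,B^k_{n_k,p_k,\boldsymbol{\xi}_k}(x_k))^\intercal$,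 let $\mathbf{G}_k=\mathbb{E}[\mathbf{P}_k(X_k)\mathbf{P}_k^\intercal(X_k)]$ (symmetric positive-definite), with Cholesky factorization $\mathbf{G}_k=\mathbf{Q}_k\mathbf{Q}_k^\intercal$, $\mathbf{Q}_k$ lower-triangular with positive diagonal. Then $\boldsymbol{\psi}_k(x_k)=\mathbf{Q}_k^{-1}\mathbf{P}_k(x_k)$ has components $\psi^k_{i,p_k,\boldsymbol{\xi}_k}(x_k)$, $i=1,\ldots,n_k$. Multivariate splines: $\bar{\mathcal{I}}_{u,\mathbf{n}_u}=\{\mathbf{i}_u=(i_{k_1},\ldots,i_{k_{|u|}}):2\le i_{k_l}\le n_{k_l},\ 1\le l\le|u|\}$ and $\Psi^u_{\mathbf{i}_u,\mathbf{p}_u,\boldsymbol{\Xi}_u}(\mathbf{x}_u)=\prod_{k\in u}\psi^k_{i_k,p_k,\boldsymbol{\xi}_k}(x_k)$. Here $L^2(\Omega,\mathcal{F},\mathbb{P})$ denotes the Hilbert space of random variables of the form $y(\mathbf{X})$, $y:\mathbb{A}^N\to\mathbb{R}$ measurable, with $\mathbb{E}[y(\mathbf{X})^2]<\infty$. SDD approximation of $y(\mathbf{X})\in L^2(\Omega,\mathcal{F},\mathbb{P})$: $y_{\mathbf{p},\boldsymbol{\Xi}}(\mathbf{X})=y_\emptyset+\sum_{\emptyset\neq u\subseteq\{1,\ldots,N\}}\sum_{\mathbf{i}_u\in\bar{\mathcal{I}}_{u,\mathbf{n}_u}}C^u_{\mathbf{i}_u,\mathbf{p}_u,\boldsymbol{\Xi}_u}\Psi^u_{\mathbf{i}_u,\mathbf{p}_u,\boldsymbol{\Xi}_u}(\mathbf{X}_u)$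 with $y_\emptyset=\mathbb{E}[y(\mathbf{X})]$ and $C^u_{\mathbf{i}_u,\mathbf{p}_u,\boldsymbol{\Xi}_u}=\mathbb{E}[y(\mathbf{X})\Psi^u_{\mathbf{i}_u,\mathbf{p}_u,\boldsymbol{\Xi}_u}(\mathbf{X}_u)]$. (Equivalently, it is the orthogonal projection of $y(\mathbf{X})$ onto the tensor-product spline space $\bigotimes_{k=1}^N\operatorname{span}\{B^k_{i,p_k,\boldsymbol{\xi}_k}:1\le i\le n_k\}$, functions equal almost everywhere being identified.) *)

theory Defs
  imports "HOL-Probability.Probability" "Jordan_Normal_Form.Gauss_Jordan_Elimination"
begin

text \<open>
  Coordinate directions are numbered \<open>1, \<dots>, N\<close>. A knot sequence for degree \<open>p\<close> and
  \<open>n\<close> basis functions is a function \<open>\<xi> :: nat \<Rightarrow> real\<close> of which only the entries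
  \<open>\<xi> 1, \<dots>, \<xi> (n + p + 1)\<close> matter.
\<close>

definition knot_values :: "nat \<Rightarrow> nat \<Rightarrow> (nat \<Rightarrow> real) \<Rightarrow> real list" where
  "knot_values p n \<xi> = sorted_list_of_set (\<xi> ` {1..n + p + 1})"

definition knot_mult :: "nat \<Rightarrow> nat \<Rightarrow> (nat \<Rightarrow> real) \<Rightarrow> real \<Rightarrow> nat" where
  "knot_mult p n \<xi> z = card {i \<in> {1..n + p + 1}. \<xi> i = z}"

definition open_knots :: "real \<Rightarrow> real \<Rightarrow> nat \<Rightarrow> nat \<Rightarrow> (nat \<Rightarrow> real) \<Rightarrow> bool" where
  "open_knots a b p n \<xi> \<longleftrightarrow>
     p < n \<and> mono_on {1..n + p + 1} \<xi> \<and>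
     hd (knot_values p n \<xi>) = a \<and> last (knot_values p n \<xi>) = b \<and>
     knot_mult p n \<xi> a = p + 1 \<and> knot_mult p n \<xi> b = p + 1 \<and>
     (\<forall>z \<in> set (knot_values p n \<xi>). knot_mult p n \<xi> z \<le> p + 1)"

definition largest_element :: "nat \<Rightarrow> nat \<Rightarrow> (nat \<Rightarrow> real) \<Rightarrow> real" where
  "largest_element p n \<xi> =
     Max {knot_values p n \<xi> ! (j + 1) - knot_values p n \<xi> ! j | j.
            j + 1 < length (knot_values p n \<xi>)}"

text \<open>The convention \<open>0 / 0 = 0\<close> is the one of HOL division.\<close>

primrec bspline :: "(nat \<Rightarrow> real) \<Rightarrow> nat \<Rightarrow> nat \<Rightarrow> real \<Rightarrow> real" where
  "bspline \<xi> 0 i x = (if \<xi> i \<le> x \<and> x < \<xi> (i + 1) then 1 else 0)"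
| "bspline \<xi> (Suc p) i x =
     (x - \<xi> i) / (\<xi> (i + Suc p) - \<xi> i) * bspline \<xi> p i x +
     (\<xi> (i + Suc p + 1) - x) / (\<xi> (i + Suc p + 1) - \<xi> (i + 1)) * bspline \<xi> p (i + 1) x"

text \<open>
  The vectors and matrices of the Jordan normal form entry are indexed from \<open>0\<close>, so the
  \<open>i\<close>-th basis function sits at index \<open>i - 1\<close>.
\<close>

definition aux_vec :: "nat \<Rightarrow> nat \<Rightarrow> (nat \<Rightarrow> real) \<Rightarrow> real \<Rightarrow> real Matrix.vec" where
  "aux_vec p n \<xi> x = Matrix.vec n (\<lambda>i. if i = 0 then 1 else bspline \<xi> p (i + 1) x)"

definition moment_mat ::
  "'a measure \<Rightarrow> ('a \<Rightarrow> real) \<Rightarrow> nat \<Rightarrow> nat \<Rightarrow> (nat \<Rightarrow> real) \<Rightarrow> real Matrix.mat" where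
  "moment_mat M Y p n \<xi> =
     Matrix.mat n n (\<lambda>(i, j).
       \<integral>\<omega>. vec_index (aux_vec p n \<xi> (Y \<omega>)) i * vec_index (aux_vec p n \<xi> (Y \<omega>)) j \<partial>M)"

definition is_cholesky :: "real Matrix.mat \<Rightarrow> real Matrix.mat \<Rightarrow> bool" where
  "is_cholesky G Q \<longleftrightarrow>
     Q \<in> carrier_mat (dim_row G) (dim_row G) \<and>
     upper_triangular (transpose_mat Q) \<and>
     (\<forall>i < dim_row G. Q $$ (i, i) > 0) \<and>
     G = Q * transpose_mat Q"

text \<open>For a symmetric positive definite matrix the Cholesky factor exists and is unique.\<close>

definition cholesky :: "real Matrix.mat \<Rightarrow> real Matrix.mat" where
  "cholesky G = (SOME Q. is_cholesky G Q)"

definition on_bspline ::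
  "'a measure \<Rightarrow> ('a \<Rightarrow> real) \<Rightarrow> nat \<Rightarrow> nat \<Rightarrow> (nat \<Rightarrow> real) \<Rightarrow> nat \<Rightarrow> real \<Rightarrow> real" where
  "on_bspline M Y p n \<xi> i x =
     vec_index (the (mat_inverse (cholesky (moment_mat M Y p n \<xi>))) *\<^sub>v aux_vec p n \<xi> x) (i - 1)"

definition multi_spline ::
  "'a measure \<Rightarrow> (nat \<Rightarrow> 'a \<Rightarrow> real) \<Rightarrow> (nat \<Rightarrow> nat) \<Rightarrow> (nat \<Rightarrow> nat) \<Rightarrow> (nat \<Rightarrow> nat \<Rightarrow> real) \<Rightarrow>
   nat set \<Rightarrow> (nat \<Rightarrow> nat) \<Rightarrow> (nat \<Rightarrow> real) \<Rightarrow> real" where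
  "multi_spline M X p n \<xi> u i x = (\<Prod>k\<in>u. on_bspline M (X k) (p k) (n k) (\<xi> k) (i k) (x k))"

definition input_space :: "nat \<Rightarrow> (nat \<Rightarrow> real) \<Rightarrow> (nat \<Rightarrow> real) \<Rightarrow> (nat \<Rightarrow> real) measure" where
  "input_space N a b = PiM {1..N} (\<lambda>k. restrict_space borel {a k..b k})"

definition random_vec :: "nat \<Rightarrow> (nat \<Rightarrow> 'a \<Rightarrow> real) \<Rightarrow> 'a \<Rightarrow> nat \<Rightarrow> real" where
  "random_vec N X \<omega> = (\<lambda>k\<in>{1..N}. X k \<omega>)"

definition sdd_coeff ::
  "'a measure \<Rightarrow> nat \<Rightarrow> (nat \<Rightarrow> 'a \<Rightarrow> real) \<Rightarrow> (nat \<Rightarrow> nat) \<Rightarrow> (nat \<Rightarrow> nat) \<Rightarrow>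
   (nat \<Rightarrow> nat \<Rightarrow> real) \<Rightarrow> ((nat \<Rightarrow> real) \<Rightarrow> real) \<Rightarrow> nat set \<Rightarrow> (nat \<Rightarrow> nat) \<Rightarrow> real" where
  "sdd_coeff M N X p n \<xi> y u i =
     (\<integral>\<omega>. y (random_vec N X \<omega>) * multi_spline M X p n \<xi> u i (random_vec N X \<omega>) \<partial>M)"

definition sdd ::
  "'a measure \<Rightarrow> nat \<Rightarrow> (nat \<Rightarrow> 'a \<Rightarrow> real) \<Rightarrow> (nat \<Rightarrow> nat) \<Rightarrow> (nat \<Rightarrow> nat) \<Rightarrow>
   (nat \<Rightarrow> nat \<Rightarrow> real) \<Rightarrow> ((nat \<Rightarrow> real) \<Rightarrow> real) \<Rightarrow> (nat \<Rightarrow> real) \<Rightarrow> real" where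
  "sdd M N X p n \<xi> y x =
     (\<integral>\<omega>. y (random_vec N X \<omega>) \<partial>M) +
     (\<Sum>u \<in> Pow {1..N} - {{}}. \<Sum>i \<in> PiE u (\<lambda>k. {2..n k}).
        sdd_coeff M N X p n \<xi> y u i * multi_spline M X p n \<xi> u i x)"

text \<open>
  Support is meant topologically: the closure of the set where the density does not vanish is
  the whole interval. The density is continuous on the interval but may jump at its end points,
  as for a uniform distribution.
\<close>

definition standing_assumptions ::
  "'a measure \<Rightarrow> nat \<Rightarrow> (nat \<Rightarrow> real) \<Rightarrow> (nat \<Rightarrow> real) \<Rightarrow> (nat \<Rightarrow> 'a \<Rightarrow> real) \<Rightarrow>
   (nat \<Rightarrow> real \<Rightarrow> real) \<Rightarrow> bool" where
  "standing_assumptions M N a b X f \<longleftrightarrow>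
     prob_space M \<and> N \<ge> 1 \<and>
     (\<forall>k\<in>{1..N}. a k < b k) \<and>
     random_vec N X \<in> measurable M (input_space N a b) \<and>
     prob_space.indep_vars M (\<lambda>_. borel) X {1..N} \<and>
     (\<forall>k\<in>{1..N}. (\<forall>x. f k x \<ge> 0) \<and>
        distributed M lborel (X k) (\<lambda>x. ennreal (f k x)) \<and>
        continuous_on {a k..b k} (f k) \<and>
        closure {x. f k x \<noteq> 0} = {a k..b k})"

end

theory Submission
  imports Defs "Jordan_Normal_Form.Determinant"
begin

text \<open>
  The SDD approximation is an orthogonal projection in mean square, and the theorem holds because
  the spaces projected onto become dense as the mesh is refined.

  Fix one direction. The functions \<open>1, B\<^sub>2, \<dots>, B\<^sub>n\<close> are linearly independent modulo null sets of the
  law of \<open>X\<^sub>k\<close>: on a knot-free interval a combination of them is a polynomial, the density does not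
  vanish on some open subinterval because its support is all of \<open>[a\<^sub>k, b\<^sub>k]\<close>, and so a combination
  that vanishes almost surely vanishes off the knots; there the orders of vanishing at the knots
  separate the B-splines (\<open>bspline_linear_independent\<close>). Hence the moment matrix is positive
  definite, a Cholesky factor exists, and the functions \<open>\<psi>\<^sub>i\<close> are orthonormal with \<open>\<psi>\<^sub>1 = 1\<close>. By
  partition of unity they span all B-splines.

  In several directions, independence makes the products of the \<open>\<psi>\<close> orthonormal. As \<open>\<psi>\<^sub>1 = 1\<close>, a
  nonempty set \<open>u\<close> together with indices at least \<open>2\<close> on \<open>u\<close> is the same as a multi-index over all
  directions different from \<open>(1, \<dots>, 1)\<close>, so the SDD sum is the projection onto the full tensor
  product space (\<open>sdd_eq_projection\<close>) and beats every other element of that space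
  (\<open>sdd_best_approximation\<close>).

  It remains to approximate \<open>y(X)\<close> by tensor product splines in any way whatsoever. For the
  indicator of a box \<open>{x. x\<^sub>k \<le> c\<^sub>k for all k}\<close> the coefficients \<open>1\<close> for \<open>\<xi>\<^sub>i \<le> c\<^sub>k\<close> and \<open>0\<close> otherwise
  do: since the supports shrink, the resulting spline agrees with the step function at any given
  point other than \<open>c\<^sub>k\<close> once the mesh is fine, and dominated convergence applies. The set of functions
  that can be approximated is a closed subspace, so it contains the indicators of all measurable
  sets (by the \<open>\<pi>\<close>-\<open>\<lambda>\<close> theorem) and then all square integrable functions (\<open>approximable_L2\<close>).

  Convergence in probability follows by Markov's inequality. For the distribution functions a shift
  of the argument by \<open>\<delta>\<close> costs at most the probability of a deviation larger than \<open>\<delta>\<close>, so they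
  converge uniformly on any set on which \<open>F\<close> is continuous with a uniform modulus: a single point of
  continuity, or the whole line if \<open>F\<close> is continuous, because \<open>F\<close> has limits at \<open>\<plusminus>\<infinity>\<close>.
\<close>

section \<open>B-splines on a knot sequence\<close>

lemma bspline_support:
  assumes "mono_on {i..i + p + 1} \<xi>" "x < \<xi> i \<or> \<xi> (i + p + 1) \<le> x"
  shows "bspline \<xi> p i x = 0"
  using assms
proof (induction p arbitrary: i)
  case 0
  then show ?case by auto
next
  case (Suc p)
  have "\<xi> i \<le> \<xi> (i + 1)" "\<xi> (i + p + 1) \<le> \<xi> (i + Suc p + 1)"
    using Suc.prems(1) by (auto intro!: mono_onD[OF Suc.prems(1)])
  moreover have "mono_on {i..i + p + 1} \<xi>" "mono_on {i + 1..i + 1 + p + 1} \<xi>"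
    using Suc.prems(1) by (auto elim!: mono_on_subset)
  ultimately have "bspline \<xi> p i x = 0" "bspline \<xi> p (i + 1) x = 0"
    using Suc.prems(2) by (auto intro!: Suc.IH simp del: bspline.simps)
  then show ?case by simp
qed

lemma bspline_nonneg:
  assumes "mono_on {i..i + p + 1} \<xi>"
  shows "0 \<le> bspline \<xi> p i x"
  using assms
proof (induction p arbitrary: i)
  case 0
  then show ?case by auto
next
  case (Suc p)
  have m: "mono_on {i..i + p + 1} \<xi>" "mono_on {i + 1..i + 1 + p + 1} \<xi>"
    using Suc.prems by (auto elim!: mono_on_subset)
  have le: "\<xi> i \<le> \<xi> (i + Suc p)" "\<xi> (i + 1) \<le> \<xi> (i + Suc p + 1)"
    by (auto intro!: mono_onD[OF Suc.prems])
  have nn: "0 \<le> bspline \<xi> p i x" "0 \<le> bspline \<xi> p (i + 1) x"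
    using Suc.IH m by blast+
  have "0 \<le> (x - \<xi> i) / (\<xi> (i + Suc p) - \<xi> i) * bspline \<xi> p i x"
  proof (cases "x < \<xi> i")
    case True
    then show ?thesis using bspline_support[OF m(1)] by simp
  next
    case False
    then show ?thesis using le nn by (intro mult_nonneg_nonneg divide_nonneg_nonneg) auto
  qed
  moreover have "0 \<le> (\<xi> (i + Suc p + 1) - x) / (\<xi> (i + Suc p + 1) - \<xi> (i + 1)) * bspline \<xi> p (i + 1) x"
  proof (cases "\<xi> (i + 1 + p + 1) \<le> x")
    case True
    then show ?thesis using bspline_support[OF m(2)] by simp
  next
    case False
    then show ?thesis using le nn by (intro mult_nonneg_nonneg divide_nonneg_nonneg) auto
  qed
  ultimately show ?case by simp
qed

lemma bspline_measurable [measurable]: "bspline \<xi> p i \<in> borel_measurable borel"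
proof (induction p arbitrary: i)
  case 0
  have "bspline \<xi> 0 i = (\<lambda>x. if x \<in> {\<xi> i..<\<xi> (i + 1)} then 1 else 0)" by auto
  then show ?case by simp
next
  case (Suc p)
  note [measurable] = Suc.IH
  have "bspline \<xi> (Suc p) i = (\<lambda>x. (x - \<xi> i) / (\<xi> (i + Suc p) - \<xi> i) * bspline \<xi> p i x +
     (\<xi> (i + Suc p + 1) - x) / (\<xi> (i + Suc p + 1) - \<xi> (i + 1)) * bspline \<xi> p (i + 1) x)"
    by (rule ext) simp
  then show ?case by simp
qed

text \<open>
  The recursion distributes each B-spline of degree \<open>d\<close> over two of degree \<open>d + 1\<close>, with weights that
  add up to one; only the two outermost terms are lost, and their supports do not contain \<open>x\<close>.
\<close>

lemma bspline_partition_of_unity: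
  assumes "mono_on {j..r + d + 1} \<xi>" "\<xi> (j + d) \<le> x" "x < \<xi> (r + 1)" "j + d \<le> r"
  shows "(\<Sum>i = j..r. bspline \<xi> d i x) = 1"
  using assms
proof (induction d arbitrary: j)
  case 0
  \<comment> \<open>For degree \<open>0\<close> the summands are differences of these indicators, and the sum telescopes.\<close>
  let ?g = "\<lambda>i. of_bool (\<xi> i \<le> x) :: real"
  have "(\<Sum>i = j..r. bspline \<xi> 0 i x) = (\<Sum>i = j..r. ?g i - ?g (i + 1))"
  proof (rule sum.cong[OF refl])
    fix i assume "i \<in> {j..r}"
    then have "\<xi> i \<le> \<xi> (i + 1)" using 0 by (auto intro!: mono_onD[OF 0(1)])
    then show "bspline \<xi> 0 i x = ?g i - ?g (i + 1)" by auto
  qed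
  also have "\<dots> = - (\<Sum>i = j..r. ?g (Suc i) - ?g i)"
    by (simp add: sum_negf[symmetric] del: sum_subtractf)
  also have "\<dots> = ?g j - ?g (Suc r)" using 0 by (subst sum_Suc_diff) auto
  also have "\<dots> = 1" using 0 by simp
  finally show ?case .
next
  case (Suc d)
  define w where "w i = (x - \<xi> i) / (\<xi> (i + Suc d) - \<xi> i)" for i
  let ?B = "\<lambda>i. bspline \<xi> d i x"
  have m: "mono_on {i..i + d + 1} \<xi>" if "j \<le> i" "i \<le> r + 1" for i
    using Suc.prems(1) by (rule mono_on_subset) (use that in auto)
  have jr: "j \<le> r" using Suc.prems by simp
  have "bspline \<xi> (Suc d) i x = w i * ?B i + (1 - w (Suc i)) * ?B (Suc i)" if i: "i \<in> {j..r}" for i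
  proof (cases "\<xi> (i + 1) = \<xi> (i + 1 + d + 1)")
    case True
    then have "x < \<xi> (i + 1) \<or> \<xi> (i + 1 + d + 1) \<le> x" by linarith
    then have "bspline \<xi> d (i + 1) x = 0"
      by (rule bspline_support[rotated]) (use m[of "i + 1"] i in auto)
    then have "?B (Suc i) = 0" by simp
    then show ?thesis by (simp add: w_def)
  next
    case False
    then have "(\<xi> (i + Suc d + 1) - x) / (\<xi> (i + Suc d + 1) - \<xi> (i + 1)) = 1 - w (Suc i)"
      by (simp add: w_def field_simps)
    then show ?thesis by (simp add: w_def)
  qed
  then have "(\<Sum>i = j..r. bspline \<xi> (Suc d) i x)
     = (\<Sum>i = j..r. w i * ?B i) + (\<Sum>i = j..r. (1 - w (Suc i)) * ?B (Suc i))"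
    by (simp add: sum.distrib)
  also have "(\<Sum>i = j..r. (1 - w (Suc i)) * ?B (Suc i)) = (\<Sum>i = Suc j..Suc r. (1 - w i) * ?B i)"
    by (subst sum.shift_bounds_cl_Suc_ivl) simp
  also have "\<dots> = (\<Sum>i = Suc j..r. (1 - w i) * ?B i)"
    using bspline_support[OF m[of "r + 1"], of x] Suc.prems by (simp add: sum.atLeastAtMost_shift_bounds)
  also have "(\<Sum>i = j..r. w i * ?B i) = (\<Sum>i = Suc j..r. w i * ?B i)"
    using bspline_support[OF m[of j], of x] Suc.prems
    by (subst sum.atLeast_Suc_atMost) auto
  also have "(\<Sum>i = Suc j..r. w i * ?B i) + (\<Sum>i = Suc j..r. (1 - w i) * ?B i) = (\<Sum>i = Suc j..r. ?B i)"
    by (subst sum.distrib[symmetric]) (simp add: algebra_simps)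
  also have "\<dots> = 1"
    by (rule Suc.IH) (use Suc.prems in \<open>auto elim!: mono_on_subset\<close>)
  finally show ?case .
qed

text \<open>
  Both weights of the recursion are affine in \<open>x\<close>, so only the degree \<open>0\<close> case sees the knots.
\<close>

lemma bspline_piecewise_poly:
  assumes "\<And>j. j \<in> {i..i + p + 1} \<Longrightarrow> \<xi> j \<le> s \<or> t \<le> \<xi> j"
  shows "\<exists>q :: real poly. \<forall>x \<in> {s<..<t}. bspline \<xi> p i x = poly q x"
  using assms
proof (induction p arbitrary: i)
  case 0
  have h: "\<xi> i \<le> s \<or> t \<le> \<xi> i" "\<xi> (i + 1) \<le> s \<or> t \<le> \<xi> (i + 1)" using 0 by auto
  show ?case
    by (rule exI[of _ "if \<xi> i \<le> s \<and> t \<le> \<xi> (i + 1) then 1 else 0"]) (use h in auto)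
next
  case (Suc p)
  obtain q1 where q1: "\<forall>x \<in> {s<..<t}. bspline \<xi> p i x = poly q1 x"
    using Suc.IH[of i] Suc.prems by force
  obtain q2 where q2: "\<forall>x \<in> {s<..<t}. bspline \<xi> p (i + 1) x = poly q2 x"
    using Suc.IH[of "i + 1"] Suc.prems by force
  show ?case
    by (rule exI[of _ "Polynomial.smult (1 / (\<xi> (i + Suc p) - \<xi> i)) ([:- \<xi> i, 1:] * q1) +
       Polynomial.smult (1 / (\<xi> (i + Suc p + 1) - \<xi> (i + 1))) ([:\<xi> (i + Suc p + 1), -1:] * q2)"])
       (use q1 q2 in \<open>auto simp: diff_divide_distrib left_diff_distrib\<close>)
qed

text \<open>
  If \<open>\<nu>\<close> of the knots of a B-spline of degree \<open>p\<close> coincide at the left end \<open>t\<close> of its support, it vanishes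
  there to the exact order \<open>p + 1 - \<nu>\<close>. By induction on the degree: the first term of the recursion
  gains a factor \<open>x - t\<close>, the second starts with one knot less at \<open>t\<close>. Both limits are nonnegative
  and at least one is positive, so no cancellation can occur.
\<close>

lemma bspline_leading_term:
  assumes "1 \<le> \<nu>" "\<nu> \<le> p + 1" "\<And>j. j \<in> {i..<i + \<nu>} \<Longrightarrow> \<xi> j = t"
    and "\<And>j. j \<in> {i + \<nu>..i + p + 1} \<Longrightarrow> t < \<xi> j" "mono_on {i..i + p + 1} \<xi>"
  shows "\<exists>L>0. ((\<lambda>x. bspline \<xi> p i x / (x - t) ^ (p + 1 - \<nu>)) \<longlongrightarrow> L) (at_right t)"
  using assms
proof (induction p arbitrary: i \<nu>)
  case 0
  then have "\<nu> = 1" "\<xi> i = t" "t < \<xi> (i + 1)" by auto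
  have "\<forall>\<^sub>F x in at_right t. x < \<xi> (i + 1)" using \<open>t < \<xi> (i + 1)\<close>
    by (intro order_tendstoD(2)[OF tendsto_ident_at])
  moreover have "\<forall>\<^sub>F x in at_right t. t < x" by (simp add: eventually_at_right_less)
  ultimately have "\<forall>\<^sub>F x in at_right t. bspline \<xi> 0 i x / (x - t) ^ (0 + 1 - \<nu>) = 1"
    by eventually_elim (use \<open>\<nu> = 1\<close> \<open>\<xi> i = t\<close> in auto)
  then show ?case by (intro exI[of _ 1]) (auto intro: tendsto_eventually)
next
  case (Suc p)
  have m: "mono_on {i..i + p + 1} \<xi>" "mono_on {i + 1..i + 1 + p + 1} \<xi>"
    using Suc.prems(5) by (auto elim!: mono_on_subset)
  have ti: "\<xi> i = t" using Suc.prems by auto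
  have gt: "t < \<xi> (i + Suc p + 1)" using Suc.prems by auto
  let ?e = "Suc p + 1 - \<nu>"
  let ?b1 = "\<lambda>x. (x - \<xi> i) / (\<xi> (i + Suc p) - \<xi> i) * bspline \<xi> p i x / (x - t) ^ ?e"
  let ?b2 = "\<lambda>x. (\<xi> (i + Suc p + 1) - x) / (\<xi> (i + Suc p + 1) - \<xi> (i + 1)) * bspline \<xi> p (i + 1) x / (x - t) ^ ?e"
  have pos: "\<forall>\<^sub>F x in at_right t. t < x" by (simp add: eventually_at_right_less)
  have 1: "\<exists>L. (?b1 \<longlongrightarrow> L) (at_right t) \<and> 0 \<le> L \<and> (\<nu> \<le> p + 1 \<longrightarrow> 0 < L)"
  proof (cases "\<nu> \<le> p + 1")
    case True
    have "t < \<xi> (i + Suc p)" using Suc.prems(4)[of "i + Suc p"] True by auto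
    obtain L where L: "L > 0" "((\<lambda>x. bspline \<xi> p i x / (x - t) ^ (p + 1 - \<nu>)) \<longlongrightarrow> L) (at_right t)"
      using Suc.IH[of \<nu> i] Suc.prems(1-4) m True by (auto simp del: bspline.simps)
    have "((\<lambda>x. bspline \<xi> p i x / (x - t) ^ (p + 1 - \<nu>) / (\<xi> (i + Suc p) - \<xi> i)) \<longlongrightarrow> L / (\<xi> (i + Suc p) - \<xi> i)) (at_right t)"
      by (intro tendsto_divide L tendsto_const) (use \<open>t < \<xi> (i + Suc p)\<close> ti in auto)
    moreover have "\<forall>\<^sub>F x in at_right t. bspline \<xi> p i x / (x - t) ^ (p + 1 - \<nu>) / (\<xi> (i + Suc p) - \<xi> i) = ?b1 x"
      using pos
    proof eventually_elim
      case (elim x)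
      have e: "?e = Suc (p + 1 - \<nu>)" using True by auto
      show ?case unfolding e power_Suc ti using elim by simp
    qed
    ultimately have "(?b1 \<longlongrightarrow> L / (\<xi> (i + Suc p) - \<xi> i)) (at_right t)"
      by (rule Lim_transform_eventually)
    moreover have "0 < L / (\<xi> (i + Suc p) - \<xi> i)"
      using L(1) \<open>t < \<xi> (i + Suc p)\<close> ti by simp
    ultimately show ?thesis by (intro exI[of _ "L / (\<xi> (i + Suc p) - \<xi> i)"]) simp
  next
    case False
    then have "\<xi> (i + Suc p) = t" using Suc.prems(2,3) by auto
    then show ?thesis using ti False by (intro exI[of _ 0]) auto
  qed
  have 2: "\<exists>L. (?b2 \<longlongrightarrow> L) (at_right t) \<and> 0 \<le> L \<and> (\<not> \<nu> \<le> p + 1 \<longrightarrow> 0 < L)"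
  proof (cases "\<nu> = 1")
    case True
    then have "t < \<xi> (i + 1)" using Suc.prems(4)[of "i + 1"] by auto
    then have "\<forall>\<^sub>F x in at_right t. x < \<xi> (i + 1)"
      by (intro order_tendstoD(2)[OF tendsto_ident_at])
    then have "\<forall>\<^sub>F x in at_right t. ?b2 x = 0"
      by eventually_elim (use bspline_support[OF m(2)] in auto)
    then show ?thesis using True by (intro exI[of _ 0]) (auto intro: tendsto_eventually)
  next
    case False
    then have nu: "\<nu> \<ge> 2" using Suc.prems(1) by auto
    then have ti1: "\<xi> (i + 1) = t" using Suc.prems(3) by auto
    obtain L where L: "L > 0" "((\<lambda>x. bspline \<xi> p (i + 1) x / (x - t) ^ (p + 1 - (\<nu> - 1))) \<longlongrightarrow> L) (at_right t)"
    proof -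
      have "\<exists>L>0. ((\<lambda>x. bspline \<xi> p (i + 1) x / (x - t) ^ (p + 1 - (\<nu> - 1))) \<longlongrightarrow> L) (at_right t)"
      proof (rule Suc.IH)
        show "1 \<le> \<nu> - 1" "\<nu> - 1 \<le> p + 1" using nu Suc.prems(2) by auto
        show "\<xi> j = t" if "j \<in> {i + 1..<i + 1 + (\<nu> - 1)}" for j
          using that nu by (intro Suc.prems(3)) auto
        show "t < \<xi> j" if "j \<in> {i + 1 + (\<nu> - 1)..i + 1 + p + 1}" for j
          using that nu by (intro Suc.prems(4)) auto
      qed (rule m)
      then show thesis using that by blast
    qed
    have "((\<lambda>x. (\<xi> (i + Suc p + 1) - x) / (\<xi> (i + Suc p + 1) - \<xi> (i + 1)) *
        (bspline \<xi> p (i + 1) x / (x - t) ^ (p + 1 - (\<nu> - 1)))) \<longlongrightarrow>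
        (\<xi> (i + Suc p + 1) - t) / (\<xi> (i + Suc p + 1) - \<xi> (i + 1)) * L) (at_right t)"
      by (intro tendsto_intros L) (use gt ti1 in auto)
    moreover have "(\<xi> (i + Suc p + 1) - t) / (\<xi> (i + Suc p + 1) - \<xi> (i + 1)) * L = L"
      using ti1 gt by auto
    moreover have "p + 1 - (\<nu> - 1) = ?e" using nu by auto
    ultimately have "(?b2 \<longlongrightarrow> L) (at_right t)" by simp
    then show ?thesis using L(1) by (intro exI[of _ L]) auto
  qed
  obtain L1 L2 where L: "(?b1 \<longlongrightarrow> L1) (at_right t)" "(?b2 \<longlongrightarrow> L2) (at_right t)" "0 \<le> L1" "0 \<le> L2"
    "\<nu> \<le> p + 1 \<longrightarrow> 0 < L1" "\<not> \<nu> \<le> p + 1 \<longrightarrow> 0 < L2"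
    using 1 2 by blast
  have "0 < L1 + L2" using L by linarith
  moreover have "((\<lambda>x. ?b1 x + ?b2 x) \<longlongrightarrow> L1 + L2) (at_right t)"
    by (intro tendsto_add L)
  then have "((\<lambda>x. bspline \<xi> (Suc p) i x / (x - t) ^ ?e) \<longlongrightarrow> L1 + L2) (at_right t)"
    unfolding bspline.simps(2) add_divide_distrib .
  ultimately show ?case by (intro exI[of _ "L1 + L2"] conjI)
qed

text \<open>
  Let \<open>k\<close> be the first index with a nonzero coefficient and let \<open>x\<close> approach \<open>\<xi> k\<close> from the right.
  Every later B-spline either has not started yet or has fewer knots at \<open>\<xi> k\<close>, so it vanishes there to
  a higher order than the \<open>k\<close>-th one. Dividing by the leading power isolates the coefficient of \<open>k\<close>.
\<close>

lemma bspline_linear_independent: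
  assumes mono: "mono_on {1..n + p + 1} \<xi>"
    and mult: "\<And>i. i \<in> {1..n} \<Longrightarrow> \<xi> i < \<xi> (i + p + 1)"
    and zero: "\<And>x. x \<in> {\<xi> 1<..<\<xi> (n + p + 1)} - \<xi> ` {1..n + p + 1} \<Longrightarrow>
      (\<Sum>i = 1..n. c i * bspline \<xi> p i x) = 0"
    and i: "i \<in> {1..n}"
  shows "c i = (0 :: real)"
proof (rule ccontr)
  assume "c i \<noteq> 0"
  then have ex: "\<exists>i. i \<in> {1..n} \<and> c i \<noteq> 0" using i by blast
  define k where "k = (LEAST i. i \<in> {1..n} \<and> c i \<noteq> 0)"
  have k: "k \<in> {1..n}" "c k \<noteq> 0" using LeastI_ex[OF ex] by (auto simp: k_def)
  have below: "c j = 0" if "j < k" "j \<in> {1..n}" for j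
    using not_less_Least[of j "\<lambda>i. i \<in> {1..n} \<and> c i \<noteq> 0"] that by (auto simp: k_def)
  define t where "t = \<xi> k"
  \<comment> \<open>The number of knots with index at least \<open>k\<close> that sit at \<open>t\<close>.\<close>
  define \<nu> where "\<nu> = (LEAST \<nu>. t < \<xi> (k + \<nu>))"
  have end_gt: "t < \<xi> (k + (p + 1))" using mult[OF k(1)] by (simp add: t_def)
  have nu_gt: "t < \<xi> (k + \<nu>)" unfolding \<nu>_def by (rule LeastI[of "\<lambda>\<nu>. t < \<xi> (k + \<nu>)", OF end_gt])
  have nu_le: "\<nu> \<le> p + 1" unfolding \<nu>_def by (rule Least_le[of "\<lambda>\<nu>. t < \<xi> (k + \<nu>)", OF end_gt])
  have nu_pos: "1 \<le> \<nu>" using nu_gt by (cases \<nu>) (auto simp: t_def)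
  have at_t: "\<xi> j = t" if "j \<in> {k..<k + \<nu>}" for j
  proof -
    have "j - k < \<nu>" using that by auto
    then have "\<not> t < \<xi> (k + (j - k))"
      unfolding \<nu>_def by (rule not_less_Least[of _ "\<lambda>\<nu>. t < \<xi> (k + \<nu>)"])
    then have "\<not> t < \<xi> j" using that by simp
    moreover have "t \<le> \<xi> j" unfolding t_def by (rule mono_onD[OF mono]) (use that k nu_le in auto)
    ultimately show ?thesis using that by auto
  qed
  have after_t: "\<xi> (k + \<nu>) \<le> \<xi> j" if "k + \<nu> \<le> j" "j \<le> n + p + 1" for j
    by (rule mono_onD[OF mono]) (use that k nu_le in auto)
  let ?e = "p + 1 - \<nu>"
  let ?q = "\<lambda>j x. bspline \<xi> p j x / (x - t) ^ ?e"
  have right: "\<forall>\<^sub>F x in at_right t. t < x" by (simp add: eventually_at_right_less)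
  have before: "\<forall>\<^sub>F x in at_right t. x < \<xi> (k + \<nu>)"
    using nu_gt by (intro order_tendstoD(2)[OF tendsto_ident_at])
  have m: "mono_on {j..j + p + 1} \<xi>" if "j \<in> {1..n}" for j
    by (rule mono_on_subset[OF mono]) (use that in auto)
  obtain L where L: "L > 0" "(?q k \<longlongrightarrow> L) (at_right t)"
  proof -
    have "\<exists>L>0. (?q k \<longlongrightarrow> L) (at_right t)"
    proof (rule bspline_leading_term[OF nu_pos nu_le])
      show "t < \<xi> j" if "j \<in> {k + \<nu>..k + p + 1}" for j
        using after_t[of j] that nu_gt k by auto
    qed (use at_t m[OF k(1)] in auto)
    then show thesis using that by blast
  qed
  have higher: "(?q j \<longlongrightarrow> 0) (at_right t)" if j: "j \<in> {k + 1..n}" for j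
  proof (cases "k + \<nu> \<le> j")
    case True
    have "\<forall>\<^sub>F x in at_right t. ?q j x = 0"
      using before
    proof eventually_elim
      case (elim x)
      have "x < \<xi> j" using after_t[of j] True j elim by auto
      then show ?case using bspline_support[OF m[of j]] j by auto
    qed
    then show ?thesis by (rule tendsto_eventually)
  next
    case False
    \<comment> \<open>The number of knots of the \<open>j\<close>-th B-spline that sit at \<open>t\<close>.\<close>
    let ?\<mu> = "\<nu> - (j - k)"
    have mu: "1 \<le> ?\<mu>" "?\<mu> \<le> p + 1" "j + ?\<mu> = k + \<nu>" using False j nu_le by auto
    have "\<exists>L>0. ((\<lambda>x. bspline \<xi> p j x / (x - t) ^ (p + 1 - ?\<mu>)) \<longlongrightarrow> L) (at_right t)"
    proof (rule bspline_leading_term[OF mu(1,2)])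
      show "\<xi> i = t" if "i \<in> {j..<j + ?\<mu>}" for i
        by (rule at_t) (use that mu j in auto)
      show "t < \<xi> i" if "i \<in> {j + ?\<mu>..j + p + 1}" for i
        using after_t[of i] that nu_gt j mu by auto
    qed (use m[of j] j in auto)
    then obtain L' where L': "((\<lambda>x. bspline \<xi> p j x / (x - t) ^ (p + 1 - ?\<mu>)) \<longlongrightarrow> L') (at_right t)"
      by blast
    have "((\<lambda>x. bspline \<xi> p j x / (x - t) ^ (p + 1 - ?\<mu>) * (x - t) ^ (j - k)) \<longlongrightarrow> L' * (t - t) ^ (j - k)) (at_right t)"
      by (intro tendsto_mult L' tendsto_power tendsto_diff tendsto_ident_at tendsto_const)
    then have "((\<lambda>x. bspline \<xi> p j x / (x - t) ^ (p + 1 - ?\<mu>) * (x - t) ^ (j - k)) \<longlongrightarrow> 0) (at_right t)"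
      using j by (simp add: power_0_left)
    moreover have "\<forall>\<^sub>F x in at_right t. bspline \<xi> p j x / (x - t) ^ (p + 1 - ?\<mu>) * (x - t) ^ (j - k) = ?q j x"
      using right
    proof eventually_elim
      case (elim x)
      have e: "p + 1 - ?\<mu> = ?e + (j - k)" using mu False nu_le j by auto
      show ?case unfolding e power_add using elim by simp
    qed
    ultimately show ?thesis by (rule Lim_transform_eventually)
  qed
  have "((\<lambda>x. \<Sum>j = k..n. c j * ?q j x) \<longlongrightarrow> (\<Sum>j = k..n. c j * (if j = k then L else 0))) (at_right t)"
  proof (intro tendsto_sum tendsto_mult tendsto_const)
    fix j assume "j \<in> {k..n}"
    then show "(?q j \<longlongrightarrow> (if j = k then L else 0)) (at_right t)"
      using L(2) higher[of j] by auto
  qed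
  moreover have "(\<Sum>j = k..n. c j * (if j = k then L else 0)) = (\<Sum>j \<in> {k..n}. if j = k then c k * L else 0)"
    by (rule sum.cong) auto
  moreover have "(\<Sum>j \<in> {k..n}. if j = k then c k * L else 0) = c k * L"
    by (subst sum.delta) (use k in auto)
  ultimately have lim: "((\<lambda>x. \<Sum>j = k..n. c j * ?q j x) \<longlongrightarrow> c k * L) (at_right t)" by simp
  have "\<forall>\<^sub>F x in at_right t. (\<Sum>j = k..n. c j * ?q j x) = 0"
    using right before
  proof eventually_elim
    case (elim x)
    have "\<xi> 1 \<le> t" unfolding t_def by (rule mono_onD[OF mono]) (use k in auto)
    moreover have "\<xi> (k + \<nu>) \<le> \<xi> (n + p + 1)" by (rule after_t) (use k nu_le in auto)
    moreover have "x \<notin> \<xi> ` {1..n + p + 1}"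
    proof
      assume "x \<in> \<xi> ` {1..n + p + 1}"
      then obtain j where j: "j \<in> {1..n + p + 1}" "x = \<xi> j" by blast
      show False
      proof (cases "k + \<nu> \<le> j")
        case True
        then show False using after_t[of j] j elim by auto
      next
        case False
        then have "\<xi> j \<le> \<xi> k \<or> \<xi> j = t"
          using at_t[of j] j k by (cases "k \<le> j") (auto intro: mono_onD[OF mono])
        then show False using j elim by (auto simp: t_def)
      qed
    qed
    ultimately have "(\<Sum>i = 1..n. c i * bspline \<xi> p i x) = 0"
      using elim by (intro zero) auto
    also have "(\<Sum>i = 1..n. c i * bspline \<xi> p i x) = (\<Sum>i = k..n. c i * bspline \<xi> p i x)"
      by (rule sum.mono_neutral_right) (use k below in auto)
    finally show ?case by (simp add: sum_divide_distrib[symmetric])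
  qed
  then have "((\<lambda>x. \<Sum>j = k..n. c j * ?q j x) \<longlongrightarrow> 0) (at_right t)"
    by (rule tendsto_eventually)
  from tendsto_unique[OF _ lim this] have "c k * L = 0" by simp
  then show False using k L by simp
qed

section \<open>Open knot sequences and quasi-interpolation of steps\<close>

text \<open>
  A quasi-interpolant of the indicator function of \<open>{..c}\<close>: its coefficients are the values of that
  function at the left ends of the supports.
\<close>

definition spline_step :: "nat \<Rightarrow> nat \<Rightarrow> (nat \<Rightarrow> real) \<Rightarrow> real \<Rightarrow> real \<Rightarrow> real" where
  "spline_step p n \<xi> c x = (\<Sum>i = 1..n. of_bool (\<xi> i \<le> c) * bspline \<xi> p i x)"

context
  fixes a b :: real and p n :: nat and \<xi> :: "nat \<Rightarrow> real"
  assumes open_knots: "open_knots a b p n \<xi>" and ab: "a < b"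
begin

lemma open_knots_mono: "mono_on {1..n + p + 1} \<xi>" and open_knots_degree: "p < n"
  using open_knots by (auto simp: open_knots_def)

lemma set_knot_values: "set (knot_values p n \<xi>) = \<xi> ` {1..n + p + 1}"
  by (simp add: knot_values_def)

lemma open_knots_range:
  assumes "i \<in> {1..n + p + 1}"
  shows "a \<le> \<xi> i" "\<xi> i \<le> b"
proof -
  let ?L = "knot_values p n \<xi>"
  have s: "sorted ?L" by (simp add: knot_values_def)
  have mem: "\<xi> i \<in> set ?L" using assms set_knot_values by auto
  then obtain j where j: "j < length ?L" "?L ! j = \<xi> i" by (auto simp: in_set_conv_nth)
  then have ne: "?L \<noteq> []" by auto
  have "hd ?L \<le> \<xi> i" using sorted_nth_mono[OF s, of 0 j] j ne by (simp add: hd_conv_nth)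
  then show "a \<le> \<xi> i" using open_knots by (simp add: open_knots_def)
  have "\<xi> i \<le> last ?L" using sorted_nth_mono[OF s, of j "length ?L - 1"] j ne by (simp add: last_conv_nth)
  then show "\<xi> i \<le> b" using open_knots by (simp add: open_knots_def)
qed

text \<open>
  The value \<open>a\<close> is minimal, so by monotonicity it occupies an initial segment of the indices, and
  its multiplicity \<open>p + 1\<close> gives the length of the segment.
\<close>

lemma open_knots_first:
  assumes "i \<in> {1..p + 1}"
  shows "\<xi> i = a"
proof (rule ccontr)
  assume "\<xi> i \<noteq> a"
  then have gt: "a < \<xi> i" using open_knots_range(1)[of i] assms by auto
  have "{j \<in> {1..n + p + 1}. \<xi> j = a} \<subseteq> {1..<i}"
  proof clarify
    fix j assume j: "j \<in> {1..n + p + 1}" "a = \<xi> j"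
    have "\<not> i \<le> j"
    proof
      assume "i \<le> j"
      then have "\<xi> i \<le> \<xi> j" using j assms by (intro mono_onD[OF open_knots_mono]) auto
      then show False using gt j by simp
    qed
    then show "j \<in> {1..<i}" using j by simp
  qed
  from card_mono[OF _ this] have "knot_mult p n \<xi> a \<le> i - 1"
    by (simp add: knot_mult_def)
  then show False using assms open_knots by (auto simp: open_knots_def)
qed

lemma open_knots_last:
  assumes "i \<in> {n + 1..n + p + 1}"
  shows "\<xi> i = b"
proof (rule ccontr)
  assume "\<xi> i \<noteq> b"
  then have lt: "\<xi> i < b" using open_knots_range(2)[of i] assms by auto
  have "{j \<in> {1..n + p + 1}. \<xi> j = b} \<subseteq> {i + 1..n + p + 1}"
  proof clarify
    fix j assume j: "j \<in> {1..n + p + 1}" "b = \<xi> j"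
    have "\<not> j \<le> i"
    proof
      assume "j \<le> i"
      then have "\<xi> j \<le> \<xi> i" using j assms by (intro mono_onD[OF open_knots_mono]) auto
      then show False using lt j by simp
    qed
    then show "j \<in> {i + 1..n + p + 1}" using j by simp
  qed
  from card_mono[OF _ this] have "knot_mult p n \<xi> b \<le> n + p + 1 - i"
    by (simp add: knot_mult_def)
  then show False using assms open_knots by (auto simp: open_knots_def)
qed

text \<open>
  Otherwise \<open>p + 2\<close> knots would coincide, which the bound on the multiplicities excludes.
\<close>

lemma open_knots_support_nontrivial:
  assumes i: "i \<in> {1..n}"
  shows "\<xi> i < \<xi> (i + p + 1)"
proof (rule ccontr)
  assume "\<not> \<xi> i < \<xi> (i + p + 1)"
  then have le: "\<xi> (i + p + 1) \<le> \<xi> i" by simp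
  have "{i..i + p + 1} \<subseteq> {j \<in> {1..n + p + 1}. \<xi> j = \<xi> i}"
  proof (clarify, intro conjI)
    fix j assume j: "j \<in> {i..i + p + 1}"
    then show "j \<in> {1..n + p + 1}" using i by auto
    have "\<xi> i \<le> \<xi> j" "\<xi> j \<le> \<xi> (i + p + 1)"
      using i j by (auto intro!: mono_onD[OF open_knots_mono])
    then show "\<xi> j = \<xi> i" using le by simp
  qed
  from card_mono[OF _ this] have "p + 2 \<le> knot_mult p n \<xi> (\<xi> i)"
    by (simp add: knot_mult_def)
  moreover have "\<xi> i \<in> set (knot_values p n \<xi>)" using i set_knot_values by auto
  then have "knot_mult p n \<xi> (\<xi> i) \<le> p + 1" using open_knots by (auto simp: open_knots_def)
  ultimately show False by simp
qed

lemma knot_step_le_largest_element: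
  assumes i: "i \<in> {1..n + p}"
  shows "\<xi> (i + 1) - \<xi> i \<le> largest_element p n \<xi>"
proof -
  let ?L = "knot_values p n \<xi>"
  let ?S = "{?L ! (j + 1) - ?L ! j | j. j + 1 < length ?L}"
  have s: "sorted_wrt (<) ?L" by (simp add: knot_values_def)
  have fin: "finite ?S"
    by (rule finite_subset[of _ "(\<lambda>j. ?L ! (j + 1) - ?L ! j) ` {..<length ?L}"]) auto
  have step: "\<xi> (k + 1) - \<xi> k \<le> largest_element p n \<xi>"
    if k: "k \<in> {1..n + p}" "\<xi> k < \<xi> (k + 1)" for k
  proof -
    have "\<xi> k \<in> set ?L" "\<xi> (k + 1) \<in> set ?L" using k set_knot_values by auto
    then obtain j j' where j: "j < length ?L" "?L ! j = \<xi> k" "j' < length ?L" "?L ! j' = \<xi> (k + 1)"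
      by (auto simp: in_set_conv_nth)
    have "j < j'"
    proof (rule ccontr)
      assume "\<not> j < j'"
      then have "j' = j \<or> j' < j" by auto
      then have "?L ! j' \<le> ?L ! j" using sorted_wrt_nth_less[OF s, of j' j] j by auto
      then show False using j k by simp
    qed
    then have len: "j + 1 < length ?L" using j by simp
    then have "?L ! (j + 1) \<in> \<xi> ` {1..n + p + 1}"
      using set_knot_values nth_mem by blast
    then obtain l where l: "l \<in> {1..n + p + 1}" "?L ! (j + 1) = \<xi> l" by blast
    have "\<xi> k < \<xi> l" using sorted_wrt_nth_less[OF s, of j "j + 1"] len j l by simp
    have "\<not> l \<le> k"
    proof
      assume "l \<le> k"
      then have "\<xi> l \<le> \<xi> k" using l k by (intro mono_onD[OF open_knots_mono]) auto
      then show False using \<open>\<xi> k < \<xi> l\<close> by simp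
    qed
    then have "\<xi> (k + 1) \<le> \<xi> l" using l k by (intro mono_onD[OF open_knots_mono]) auto
    then have "\<xi> (k + 1) - \<xi> k \<le> ?L ! (j + 1) - ?L ! j" using l j by simp
    also have "\<dots> \<le> Max ?S" by (rule Max_ge[OF fin]) (use len in auto)
    finally show ?thesis by (simp add: largest_element_def)
  qed
  show ?thesis
  proof (cases "\<xi> i < \<xi> (i + 1)")
    case True
    then show ?thesis using step i by blast
  next
    case False
    \<comment> \<open>For coinciding neighbours nonnegativity of the largest element is needed; any proper step gives it.\<close>
    have "\<exists>k \<in> {1..n + p}. \<xi> k < \<xi> (k + 1)"
    proof (rule ccontr)
      assume none: "\<not> ?thesis"
      have "\<xi> (Suc k) \<le> \<xi> 1" if "k \<le> n + p" for k
        using that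
      proof (induction k)
        case (Suc k)
        then have "\<xi> (Suc (Suc k)) \<le> \<xi> (Suc k)" using none by (auto simp: not_less)
        then show ?case using Suc by auto
      qed auto
      from this[of "n + p"] show False
        using open_knots_first[of 1] open_knots_last[of "n + p + 1"] ab by auto
    qed
    then obtain k where "k \<in> {1..n + p}" "\<xi> k < \<xi> (k + 1)" by blast
    then show ?thesis using step[of k] False by linarith
  qed
qed

lemma knot_span_le:
  assumes "1 \<le> i" "i + d \<le> n + p + 1"
  shows "\<xi> (i + d) - \<xi> i \<le> d * largest_element p n \<xi>"
  using assms
proof (induction d)
  case (Suc d)
  then show ?case using knot_step_le_largest_element[of "i + d"] by (auto simp: algebra_simps)
qed simp

lemma open_knots_partition_of_unity:
  assumes "x \<in> {a..<b}"
  shows "(\<Sum>i = 1..n. bspline \<xi> p i x) = 1"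
  by (rule bspline_partition_of_unity)
     (use assms open_knots_mono open_knots_degree open_knots_first[of "1 + p"] open_knots_last[of "n + 1"] in auto)

lemma open_knots_bspline_nonneg:
  assumes "i \<in> {1..n}"
  shows "0 \<le> bspline \<xi> p i x"
  by (rule bspline_nonneg, rule mono_on_subset[OF open_knots_mono]) (use assms in auto)

lemma open_knots_bspline_support:
  assumes "i \<in> {1..n}" "bspline \<xi> p i x \<noteq> 0"
  shows "\<xi> i \<le> x" "x < \<xi> (i + p + 1)"
proof -
  have "mono_on {i..i + p + 1} \<xi>" by (rule mono_on_subset[OF open_knots_mono]) (use assms in auto)
  from bspline_support[OF this, of x] assms show "\<xi> i \<le> x" "x < \<xi> (i + p + 1)"
    by (meson not_less)+
qed

lemma open_knots_bspline_le_1: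
  assumes "i \<in> {1..n}"
  shows "bspline \<xi> p i x \<le> 1"
proof (cases "bspline \<xi> p i x = 0")
  case False
  from open_knots_bspline_support[OF assms False] have "x \<in> {a..<b}"
    using open_knots_range[of i] open_knots_range[of "i + p + 1"] assms by auto
  from open_knots_partition_of_unity[OF this] show ?thesis
    using member_le_sum[OF assms, of "\<lambda>i. bspline \<xi> p i x"] open_knots_bspline_nonneg by auto
qed simp

lemma spline_step_bounds:
  assumes "x \<in> {a..<b}"
  shows "0 \<le> spline_step p n \<xi> c x" "spline_step p n \<xi> c x \<le> 1"
proof -
  show "0 \<le> spline_step p n \<xi> c x"
    unfolding spline_step_def using open_knots_bspline_nonneg by (intro sum_nonneg) auto
  have "spline_step p n \<xi> c x \<le> (\<Sum>i = 1..n. bspline \<xi> p i x)"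
    unfolding spline_step_def using open_knots_bspline_nonneg by (intro sum_mono) auto
  then show "spline_step p n \<xi> c x \<le> 1" using open_knots_partition_of_unity[OF assms] by simp
qed

text \<open>
  A B-spline that is nonzero at \<open>x\<close> starts at most \<open>p + 1\<close> mesh sizes to the left of \<open>x\<close>. If \<open>c\<close> is
  farther away than that, all relevant coefficients have the same value, and partition of unity applies.
\<close>

lemma spline_step_eq:
  assumes x: "x \<in> {a..<b}" and far: "(p + 1) * largest_element p n \<xi> < \<bar>x - c\<bar>"
  shows "spline_step p n \<xi> c x = of_bool (x \<le> c)"
proof -
  have "spline_step p n \<xi> c x = (\<Sum>i = 1..n. of_bool (x \<le> c) * bspline \<xi> p i x)"
    unfolding spline_step_def
  proof (rule sum.cong[OF refl])
    fix i assume i: "i \<in> {1..n}"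
    show "of_bool (\<xi> i \<le> c) * bspline \<xi> p i x = of_bool (x \<le> c) * bspline \<xi> p i x"
    proof (cases "bspline \<xi> p i x = 0")
      case False
      note s = open_knots_bspline_support[OF i False]
      have "\<xi> (i + (p + 1)) - \<xi> i \<le> (p + 1) * largest_element p n \<xi>"
        by (rule knot_span_le) (use i in auto)
      then have "\<xi> i \<le> c \<longleftrightarrow> x \<le> c" using s far by (auto simp: add.assoc)
      then show ?thesis by simp
    qed simp
  qed
  also have "\<dots> = of_bool (x \<le> c)"
    using open_knots_partition_of_unity[OF x] by (simp flip: sum_distrib_left)
  finally show ?thesis .
qed

end

section \<open>Cholesky factors of positive definite matrices\<close>

lemma lower_triangular_mat_inverse:
  fixes Q :: "real mat"
  assumes Q: "Q \<in> carrier_mat n n" and pos: "\<And>i. i < n \<Longrightarrow> 0 < Q $$ (i, i)"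
    and tri: "\<And>i j. i < j \<Longrightarrow> j < n \<Longrightarrow> Q $$ (i, j) = 0"
  obtains R where "mat_inverse Q = Some R" "R \<in> carrier_mat n n" "Q * R = 1\<^sub>m n" "R * Q = 1\<^sub>m n"
proof -
  have "det Q = prod_list (diag_mat Q)" by (rule det_lower_triangular[OF tri Q])
  also have "\<dots> \<noteq> 0"
  proof
    assume "prod_list (diag_mat Q) = 0"
    then obtain i where "i < n" "Q $$ (i, i) = 0"
      using Q by (auto simp: prod_list_zero_iff diag_mat_def)
    then show False using pos[of i] by simp
  qed
  finally have "Q \<in> Units (ring_mat TYPE(real) n (undefined :: nat))"
    by (rule det_non_zero_imp_unit[OF Q])
  then obtain R where "mat_inverse Q = Some R"
    using mat_inverse(1)[OF Q, where b = "undefined :: nat"] by (cases "mat_inverse Q") auto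
  with mat_inverse(2)[OF Q this] show thesis using that by blast
qed

text \<open>
  Induction on the dimension: the new row \<open>(w, \<delta>)\<close> must satisfy \<open>q w = g(\<cdot>, n)\<close> and
  \<open>\<delta>\<^sup>2 = g(n, n) - |w|\<^sup>2\<close>. The second number is the Schur complement; it is positive as it is the value of
  the quadratic form at \<open>(v, -1)\<close>, where \<open>v\<close> solves the transposed system \<open>q\<^sup>T v = w\<close>.
\<close>

lemma cholesky_factor_exists:
  fixes g :: "nat \<Rightarrow> nat \<Rightarrow> real"
  assumes sym: "\<And>i j. g i j = g j i"
    and pd: "\<And>c. \<exists>i<n. c i \<noteq> 0 \<Longrightarrow> 0 < (\<Sum>i<n. \<Sum>j<n. c i * c j * g i j)"
  shows "\<exists>q. (\<forall>i<n. 0 < q i i) \<and> (\<forall>i j. i < j \<longrightarrow> q i j = 0) \<and>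
     (\<forall>i<n. \<forall>j<n. g i j = (\<Sum>k<n. q i k * q j k))"
  using pd
proof (induction n)
  case 0
  then show ?case by (intro exI[of _ "\<lambda>i j. 0"]) auto
next
  case (Suc n)
  have "\<exists>q. (\<forall>i<n. 0 < q i i) \<and> (\<forall>i j. i < j \<longrightarrow> q i j = 0) \<and>
     (\<forall>i<n. \<forall>j<n. g i j = (\<Sum>k<n. q i k * q j k))"
  proof (rule Suc.IH)
    fix c :: "nat \<Rightarrow> real" assume "\<exists>i<n. c i \<noteq> 0"
    then obtain i where i: "i < n" "c i \<noteq> 0" by blast
    let ?d = "\<lambda>i. if i < n then c i else 0"
    have "0 < (\<Sum>i<Suc n. \<Sum>j<Suc n. ?d i * ?d j * g i j)"
      by (rule Suc.prems) (use i in \<open>auto intro!: exI[of _ i]\<close>)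
    also have "\<dots> = (\<Sum>i<n. \<Sum>j<n. ?d i * ?d j * g i j)" by simp
    also have "\<dots> = (\<Sum>i<n. \<Sum>j<n. c i * c j * g i j)" by (intro sum.cong refl) simp
    finally show "0 < (\<Sum>i<n. \<Sum>j<n. c i * c j * g i j)" .
  qed
  then obtain q where q_facts: "(\<forall>i<n. 0 < q i i) \<and> (\<forall>i j. i < j \<longrightarrow> q i j = 0) \<and>
     (\<forall>i<n. \<forall>j<n. g i j = (\<Sum>k<n. q i k * q j k))" by (elim exE)
  then have q: "\<And>i. i < n \<Longrightarrow> 0 < q i i" "\<And>i j. i < j \<Longrightarrow> q i j = 0"
    "\<And>i j. i < n \<Longrightarrow> j < n \<Longrightarrow> g i j = (\<Sum>k<n. q i k * q j k)"
    by simp_all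
  define Q where "Q = mat n n (\<lambda>(i, j). q i j)"
  obtain R where R: "R \<in> carrier_mat n n" "Q * R = 1\<^sub>m n" "R * Q = 1\<^sub>m n"
    by (rule lower_triangular_mat_inverse[of Q n]) (auto simp: Q_def q)
  have QR: "(\<Sum>k<n. q i k * R $$ (k, j)) = of_bool (i = j)" if "i < n" "j < n" for i j
  proof -
    have "(Q * R) $$ (i, j) = of_bool (i = j)" using that by (simp add: R)
    then show ?thesis using that R(1) by (simp add: Q_def scalar_prod_def atLeast0LessThan)
  qed
  have RQ: "(\<Sum>k<n. R $$ (i, k) * q k j) = of_bool (i = j)" if "i < n" "j < n" for i j
  proof -
    have "(R * Q) $$ (i, j) = of_bool (i = j)" using that by (simp add: R)
    then show ?thesis using that R(1) by (simp add: Q_def scalar_prod_def atLeast0LessThan)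
  qed
  define w where "w k = (\<Sum>i<n. R $$ (k, i) * g i n)" for k
  define v where "v i = (\<Sum>k<n. R $$ (k, i) * w k)" for i
  have qw: "(\<Sum>k<n. q i k * w k) = g i n" if i: "i < n" for i
  proof -
    have "(\<Sum>k<n. q i k * w k) = (\<Sum>k<n. \<Sum>j<n. q i k * R $$ (k, j) * g j n)"
      by (simp add: w_def sum_distrib_left mult.assoc)
    also have "\<dots> = (\<Sum>j<n. (\<Sum>k<n. q i k * R $$ (k, j)) * g j n)"
      by (subst sum.swap) (simp add: sum_distrib_right)
    also have "\<dots> = (\<Sum>j<n. of_bool (i = j) * g j n)"
      by (rule sum.cong) (use QR i in auto)
    also have "\<dots> = g i n" using i by (simp add: sum.delta)
    finally show ?thesis .
  qed
  have qv: "(\<Sum>i<n. v i * q i k) = w k" if k: "k < n" for k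
  proof -
    have "(\<Sum>i<n. v i * q i k) = (\<Sum>i<n. \<Sum>j<n. R $$ (j, i) * q i k * w j)"
      unfolding v_def sum_distrib_right by (intro sum.cong refl) (simp add: mult_ac)
    also have "\<dots> = (\<Sum>j<n. (\<Sum>i<n. R $$ (j, i) * q i k) * w j)"
      by (subst sum.swap) (simp add: sum_distrib_right)
    also have "\<dots> = (\<Sum>j<n. of_bool (j = k) * w j)"
      by (rule sum.cong) (use RQ k in auto)
    also have "\<dots> = w k" using k by (simp add: sum.delta)
    finally show ?thesis .
  qed
  let ?S = "\<Sum>k<n. (w k)\<^sup>2"
  have vv: "(\<Sum>i<n. \<Sum>j<n. v i * v j * g i j) = ?S"
  proof -
    have "(\<Sum>i<n. \<Sum>j<n. v i * v j * g i j) = (\<Sum>i<n. \<Sum>j<n. \<Sum>k<n. (v i * q i k) * (v j * q j k))"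
      by (intro sum.cong refl) (simp add: q(3) sum_distrib_left mult_ac)
    also have "\<dots> = (\<Sum>i<n. \<Sum>k<n. (v i * q i k) * (\<Sum>j<n. v j * q j k))"
      unfolding sum_distrib_left by (intro sum.cong refl sum.swap)
    also have "\<dots> = (\<Sum>k<n. (\<Sum>i<n. v i * q i k) * (\<Sum>j<n. v j * q j k))"
      by (subst sum.swap) (simp add: sum_distrib_right)
    also have "\<dots> = ?S" by (rule sum.cong) (auto simp: qv power2_eq_square)
    finally show ?thesis .
  qed
  have vg: "(\<Sum>i<n. v i * g i n) = ?S"
  proof -
    have "(\<Sum>i<n. v i * g i n) = (\<Sum>i<n. \<Sum>k<n. v i * q i k * w k)"
      by (intro sum.cong refl) (simp add: qw[symmetric] sum_distrib_left mult_ac)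
    also have "\<dots> = (\<Sum>k<n. (\<Sum>i<n. v i * q i k) * w k)"
      by (subst sum.swap) (simp add: sum_distrib_right)
    also have "\<dots> = ?S" by (rule sum.cong) (auto simp: qv power2_eq_square)
    finally show ?thesis .
  qed
  have "?S < g n n"
  proof -
    let ?c = "v(n := -1)"
    have "0 < (\<Sum>i<Suc n. \<Sum>j<Suc n. ?c i * ?c j * g i j)"
      by (rule Suc.prems) (auto intro: exI[of _ n])
    also have "\<dots> = (\<Sum>i<n. \<Sum>j<n. v i * v j * g i j) - 2 * (\<Sum>i<n. v i * g i n) + g n n"
      by (simp add: sum.distrib sum_negf sum_subtractf sym)
    finally show ?thesis using vv vg by simp
  qed
  define \<delta> where "\<delta> = sqrt (g n n - ?S)"
  have delta: "\<delta> > 0" "\<delta> * \<delta> = g n n - ?S" using \<open>?S < g n n\<close> by (auto simp: \<delta>_def)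
  define q' where "q' i j = (if i < n then q i j else if j < n then w j else if i = n \<and> j = n then \<delta> else 0)" for i j
  have qn: "q i n = 0" if "i < n" for i using q(2) that by auto
  show ?case
  proof (rule exI[of _ q'], intro conjI allI impI)
    show "0 < q' i i" if "i < Suc n" for i using that q delta by (auto simp: q'_def less_Suc_eq)
    show "q' i j = 0" if "i < j" for i j using that q(2) by (auto simp: q'_def)
    fix i j assume "i < Suc n" "j < Suc n"
    then consider "i < n" "j < n" | "i < n" "j = n" | "i = n" "j < n" | "i = n" "j = n" by linarith
    then show "g i j = (\<Sum>k<Suc n. q' i k * q' j k)"
    proof cases
      case 1
      then show ?thesis by (simp add: q'_def qn q(3))
    next
      case 2
      then show ?thesis by (simp add: q'_def qn flip: qw)
    next
      case 3
      then show ?thesis by (simp add: q'_def qn sym[of n j] mult.commute flip: qw)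
    next
      case 4
      then show ?thesis using delta by (simp add: q'_def power2_eq_square)
    qed
  qed
qed

lemma is_cholesky_cholesky:
  fixes G :: "real mat"
  assumes G: "G \<in> carrier_mat n n" and sym: "\<And>i j. i < n \<Longrightarrow> j < n \<Longrightarrow> G $$ (i, j) = G $$ (j, i)"
    and pd: "\<And>c. \<exists>i<n. c i \<noteq> 0 \<Longrightarrow> 0 < (\<Sum>i<n. \<Sum>j<n. c i * c j * G $$ (i, j))"
  shows "is_cholesky G (cholesky G)"
proof -
  define g where "g i j = (if i < n \<and> j < n then G $$ (i, j) else 0)" for i j
  have "\<exists>q. (\<forall>i<n. 0 < q i i) \<and> (\<forall>i j. i < j \<longrightarrow> q i j = 0) \<and>
     (\<forall>i<n. \<forall>j<n. g i j = (\<Sum>k<n. q i k * q j k))"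
  proof (rule cholesky_factor_exists)
    show "g i j = g j i" for i j using sym by (auto simp: g_def)
    show "0 < (\<Sum>i<n. \<Sum>j<n. c i * c j * g i j)" if "\<exists>i<n. c i \<noteq> 0" for c
      using pd[OF that] by (simp add: g_def)
  qed
  then obtain q where "(\<forall>i<n. 0 < q i i) \<and> (\<forall>i j. i < j \<longrightarrow> q i j = 0) \<and>
     (\<forall>i<n. \<forall>j<n. g i j = (\<Sum>k<n. q i k * q j k))" by (elim exE)
  then have q: "\<And>i. i < n \<Longrightarrow> 0 < q i i" "\<And>i j. i < j \<Longrightarrow> q i j = 0"
    "\<And>i j. i < n \<Longrightarrow> j < n \<Longrightarrow> g i j = (\<Sum>k<n. q i k * q j k)"
    by simp_all
  define Q where "Q = mat n n (\<lambda>(i, j). q i j)"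
  have Q: "Q \<in> carrier_mat n n" by (simp add: Q_def)
  have G_eq: "G = Q * transpose_mat Q"
  proof (rule eq_matI)
    fix i j assume "i < dim_row (Q * transpose_mat Q)" "j < dim_col (Q * transpose_mat Q)"
    then have ij: "i < n" "j < n" using Q by auto
    have "G $$ (i, j) = (\<Sum>k<n. q i k * q j k)" using q(3)[of i j] ij by (simp add: g_def)
    also have "\<dots> = (\<Sum>k<n. Q $$ (i, k) * Q $$ (j, k))"
      by (rule sum.cong[OF refl]) (use ij in \<open>simp add: Q_def\<close>)
    also have "\<dots> = (Q * transpose_mat Q) $$ (i, j)"
      using ij Q by (simp add: scalar_prod_def atLeast0LessThan)
    finally show "G $$ (i, j) = (Q * transpose_mat Q) $$ (i, j)" .
  qed (use G Q in auto)
  have "upper_triangular (transpose_mat Q)"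
    by (rule upper_triangularI) (simp add: Q_def q(2))
  moreover have "\<forall>i<n. 0 < Q $$ (i, i)" by (simp add: Q_def q(1))
  ultimately have "is_cholesky G Q"
    using G G_eq Q unfolding is_cholesky_def by (intro conjI) (simp_all only: carrier_matD)
  then show ?thesis unfolding cholesky_def by (rule someI)
qed

section \<open>Orthonormalized B-splines of one random variable\<close>

abbreviation aux_fun :: "nat \<Rightarrow> nat \<Rightarrow> (nat \<Rightarrow> real) \<Rightarrow> nat \<Rightarrow> real \<Rightarrow> real" where
  "aux_fun p n \<xi> i x \<equiv> vec_index (aux_vec p n \<xi> x) i"

lemma aux_fun_eq:
  assumes "i < n"
  shows "aux_fun p n \<xi> i x = (if i = 0 then 1 else bspline \<xi> p (i + 1) x)"
  using assms by (simp add: aux_vec_def)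

text \<open>
  One direction: a random variable \<open>Y\<close> with density \<open>f\<close> and an open knot sequence on its range.
\<close>

locale spline_input = prob_space M for M :: "'a measure" +
  fixes Y :: "'a \<Rightarrow> real" and f :: "real \<Rightarrow> real" and a b :: real
    and p n :: nat and \<xi> :: "nat \<Rightarrow> real"
  assumes ab: "a < b" and f_nonneg: "0 \<le> f x"
    and Y_distr: "distributed M lborel Y (\<lambda>x. ennreal (f x))"
    and f_cont: "continuous_on {a..b} f"
    and f_support: "closure {x. f x \<noteq> 0} = {a..b}"
    and knots: "open_knots a b p n \<xi>"
begin

lemma Y_measurable [measurable]: "Y \<in> borel_measurable M"
  using Y_distr by (simp add: distributed_def)

lemma f_measurable [measurable]: "(\<lambda>x. ennreal (f x)) \<in> borel_measurable borel"
  using Y_distr by (simp add: distributed_def)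

text \<open>
  Almost sure statements about \<open>Y\<close> turn into statements about Lebesgue measure on the set where the
  density does not vanish.
\<close>

lemma AE_Y_iff:
  assumes [measurable]: "Measurable.pred borel P"
  shows "(AE \<omega> in M. P (Y \<omega>)) \<longleftrightarrow> (AE x in lborel. f x \<noteq> 0 \<longrightarrow> P x)"
proof -
  have d: "distr M lborel Y = density lborel (\<lambda>x. ennreal (f x))"
    using Y_distr by (simp add: distributed_def)
  have "(AE \<omega> in M. P (Y \<omega>)) \<longleftrightarrow> (AE x in distr M lborel Y. P x)"
    by (subst AE_distr_iff) auto
  also have "\<dots> \<longleftrightarrow> (AE x in lborel. 0 < ennreal (f x) \<longrightarrow> P x)"
    unfolding d by (subst AE_density) auto
  also have "\<dots> \<longleftrightarrow> (AE x in lborel. f x \<noteq> 0 \<longrightarrow> P x)"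
    using f_nonneg by (simp add: less_le[of 0])
  finally show ?thesis .
qed

lemma AE_Y_neq: "AE \<omega> in M. Y \<omega> \<noteq> c"
  by (subst AE_Y_iff) (auto intro: AE_mp[OF AE_lborel_singleton[of c]])

text \<open>
  The B-splines are right-continuous and vanish at \<open>b\<close>, so partition of unity fails at that end
  point, which \<open>Y\<close> hits with probability zero.
\<close>

lemma AE_Y_range: "AE \<omega> in M. Y \<omega> \<in> {a..<b}"
proof (subst AE_Y_iff)
  have "f x = 0" if "x \<notin> {a..b}" for x
    using that closure_subset[of "{x. f x \<noteq> 0}"] f_support by auto
  then show "AE x in lborel. f x \<noteq> 0 \<longrightarrow> x \<in> {a..<b}"
    using AE_lborel_singleton[of b] by (auto elim!: eventually_mono) force
qed simp

lemma aux_fun_measurable [measurable]: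
  assumes "i < n" shows "aux_fun p n \<xi> i \<in> borel_measurable borel"
proof -
  have "aux_fun p n \<xi> i = (if i = 0 then (\<lambda>_. 1) else bspline \<xi> p (i + 1))"
    using assms by (auto simp: aux_fun_eq)
  then show ?thesis by simp
qed

lemma aux_fun_bound:
  assumes "i < n"
  shows "\<bar>aux_fun p n \<xi> i x\<bar> \<le> 1"
  using open_knots_bspline_nonneg[OF knots ab, of "i + 1" x]
    open_knots_bspline_le_1[OF knots ab, of "i + 1" x] assms by (auto simp: aux_fun_eq)

lemma aux_fun_integrable:
  assumes "i < n" "j < n"
  shows "integrable M (\<lambda>\<omega>. aux_fun p n \<xi> i (Y \<omega>) * aux_fun p n \<xi> j (Y \<omega>))"
proof (rule integrable_const_bound[of _ 1])
  show "AE \<omega> in M. norm (aux_fun p n \<xi> i (Y \<omega>) * aux_fun p n \<xi> j (Y \<omega>)) \<le> 1"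
    using mult_mono[OF aux_fun_bound[OF assms(1)] aux_fun_bound[OF assms(2)]]
    by (auto simp: abs_mult)
qed (use assms in measurable)

text \<open>
  The density may vanish on a set of positive measure, so an almost sure identity is available only
  where \<open>f\<close> is nonzero. As \<open>x\<close> lies in the closure of that set and \<open>f\<close> is continuous, there are
  intervals with this property arbitrarily close to \<open>x\<close>, hence one in the knot-free neighbourhood of
  \<open>x\<close>, where the combination is a polynomial; with infinitely many zeros it is the zero polynomial.
\<close>

lemma aux_combination_zero:
  assumes zero: "AE \<omega> in M. (\<Sum>i<n. c i * aux_fun p n \<xi> i (Y \<omega>)) = 0"
    and x: "x \<in> {a<..<b} - \<xi> ` {1..n + p + 1}"
  shows "(\<Sum>i<n. c i * aux_fun p n \<xi> i x) = 0"
proof -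
  let ?g = "\<lambda>x. \<Sum>i<n. c i * aux_fun p n \<xi> i x"
  have "open ({a<..<b} - \<xi> ` {1..n + p + 1})"
    by (intro open_Diff finite_imp_closed) auto
  then obtain e where e: "e > 0" "ball x e \<subseteq> {a<..<b} - \<xi> ` {1..n + p + 1}"
    using x by (meson open_contains_ball)
  have "\<exists>q :: real poly. \<forall>z \<in> {x - e<..<x + e}. aux_fun p n \<xi> i z = poly q z" if i: "i < n" for i
  proof (cases "i = 0")
    case True
    then show ?thesis using i by (intro exI[of _ 1]) (simp add: aux_fun_eq)
  next
    case False
    have "\<exists>q :: real poly. \<forall>z \<in> {x - e<..<x + e}. bspline \<xi> p (i + 1) z = poly q z"
    proof (rule bspline_piecewise_poly)
      fix j assume "j \<in> {i + 1..i + 1 + p + 1}"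
      then have "\<xi> j \<notin> ball x e" using e(2) i by auto
      then show "\<xi> j \<le> x - e \<or> x + e \<le> \<xi> j" by (auto simp: dist_real_def)
    qed
    then show ?thesis using False i by (simp add: aux_fun_eq)
  qed
  then obtain q :: "nat \<Rightarrow> real poly" where
    q: "\<And>i z. i < n \<Longrightarrow> z \<in> {x - e<..<x + e} \<Longrightarrow> aux_fun p n \<xi> i z = poly (q i) z" by metis
  define r where "r = (\<Sum>i<n. Polynomial.smult (c i) (q i))"
  have r: "?g z = poly r z" if "z \<in> {x - e<..<x + e}" for z
    using q[OF _ that] by (simp add: r_def poly_sum)
  have "x \<in> closure {x. f x \<noteq> 0}" using x f_support by auto
  then obtain z where z: "f z \<noteq> 0" "dist z x < e"
    using e(1) by (auto simp: closure_approachable)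
  have zab: "z \<in> {a<..<b}" using e(2) z(2) by (auto simp: dist_commute subset_iff)
  have "isCont f z"
    using f_cont zab by (intro continuous_on_interior[of "{a..b}"]) (auto simp: interior_atLeastAtMost_real)
  then have "\<forall>\<^sub>F w in nhds z. f w \<noteq> 0"
    using z(1) by (intro tendsto_imp_eventually_ne) (auto simp: isCont_def tendsto_at_iff_tendsto_nhds)
  then obtain d where d: "d > 0" "\<And>w. dist w z < d \<Longrightarrow> f w \<noteq> 0"
    by (auto simp: eventually_nhds_metric)
  define d' where "d' = min d (e - dist z x)"
  have d': "d' > 0" using d z by (auto simp: d'_def)
  have in_ball: "f w \<noteq> 0" "w \<in> {x - e<..<x + e}" if "w \<in> {z<..<z + d'}" for w
  proof -
    have "d' \<le> d" "d' \<le> e - dist z x" by (auto simp: d'_def)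
    then show "f w \<noteq> 0" "w \<in> {x - e<..<x + e}"
      using that d(2)[of w] unfolding dist_real_def by force+
  qed
  have "AE w in lborel. f w \<noteq> 0 \<longrightarrow> ?g w = 0"
    using zero by (subst (asm) AE_Y_iff) auto
  then have ae: "AE w in lborel. w \<in> {z<..<z + d'} \<longrightarrow> poly r w = 0"
    by (rule AE_mp) (use in_ball r in \<open>auto intro!: AE_I2\<close>)
  have "r = 0"
  proof (rule ccontr)
    assume "r \<noteq> 0"
    then have "finite {w. poly r w = 0}" by (rule poly_roots_finite)
    then have "AE w in lborel. w \<notin> {w. poly r w = 0}"
      by (intro AE_not_in finite_imp_null_set_lborel)
    with ae have "AE w in lborel. w \<notin> {z<..<z + d'}" by eventually_elim auto
    then have "emeasure lborel {z<..<z + d'} = 0"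
      by (subst (asm) AE_iff_measurable[of "{z<..<z + d'}"]) auto
    then show False using d' by simp
  qed
  then show ?thesis using r[of x] e(1) by simp
qed

text \<open>
  Writing the constant \<open>1\<close> as the sum of all B-splines turns a combination of \<open>1, B\<^sub>2, \<dots>, B\<^sub>n\<close> into
  one of \<open>B\<^sub>1, \<dots>, B\<^sub>n\<close> by an invertible change of coefficients.
\<close>

lemma aux_linear_independent:
  assumes zero: "AE \<omega> in M. (\<Sum>i<n. c i * aux_fun p n \<xi> i (Y \<omega>)) = 0" and i: "i < n"
  shows "c i = 0"
proof -
  define d where "d i = c 0 + (if i = 1 then 0 else c (i - 1))" for i
  have n: "n > 0" using i by auto
  have d: "d j = 0" if "j \<in> {1..n}" for j
  proof (rule bspline_linear_independent[OF open_knots_mono[OF knots ab] open_knots_support_nontrivial[OF knots ab] _ that])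
    fix x assume x: "x \<in> {\<xi> 1<..<\<xi> (n + p + 1)} - \<xi> ` {1..n + p + 1}"
    then have xab: "x \<in> {a<..<b} - \<xi> ` {1..n + p + 1}"
      using open_knots_first[OF knots ab, of 1] open_knots_last[OF knots ab, of "n + p + 1"] by auto
    have "(\<Sum>i = 1..n. d i * bspline \<xi> p i x) =
      c 0 * (\<Sum>i = 1..n. bspline \<xi> p i x) + (\<Sum>i = 1..n. (if i = 1 then 0 else c (i - 1)) * bspline \<xi> p i x)"
      by (simp add: d_def sum_distrib_left distrib_right sum.distrib)
    also have "(\<Sum>i = 1..n. bspline \<xi> p i x) = 1"
      using open_knots_partition_of_unity[OF knots ab, of x] xab by auto
    also have "(\<Sum>i = 1..n. (if i = 1 then 0 else c (i - 1)) * bspline \<xi> p i x)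
       = (\<Sum>i<n. (if i = 0 then 0 else c i) * bspline \<xi> p (i + 1) x)"
      by (rule sum.reindex_bij_witness[of _ "\<lambda>i. i + 1" "\<lambda>i. i - 1"]) auto
    also have "c 0 * 1 + \<dots> = (\<Sum>i<n. c i * aux_fun p n \<xi> i x)"
    proof -
      have "(\<Sum>i<n. c i * aux_fun p n \<xi> i x) =
        (\<Sum>i<n. (if i = 0 then c 0 else 0) + (if i = 0 then 0 else c i) * bspline \<xi> p (i + 1) x)"
        by (rule sum.cong) (auto simp: aux_fun_eq)
      then show ?thesis using n by (simp add: sum.distrib)
    qed
    also have "\<dots> = 0" by (rule aux_combination_zero[OF zero xab])
    finally show "(\<Sum>i = 1..n. d i * bspline \<xi> p i x) = 0" .
  qed
  have "c 0 = 0" using d[of 1] n by (simp add: d_def)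
  then show ?thesis using d[of "i + 1"] i by (cases "i = 0") (auto simp: d_def)
qed

abbreviation "G \<equiv> moment_mat M Y p n \<xi>"
abbreviation "Q \<equiv> cholesky G"

lemma aux_fun_double_sum_integral:
  "(\<integral>\<omega>. (\<Sum>i<n. \<Sum>j<n. k i j * (aux_fun p n \<xi> i (Y \<omega>) * aux_fun p n \<xi> j (Y \<omega>))) \<partial>M)
     = (\<Sum>i<n. \<Sum>j<n. k i j * G $$ (i, j))" (is "?I = _")
  and aux_fun_double_sum_integrable:
  "integrable M (\<lambda>\<omega>. \<Sum>i<n. \<Sum>j<n. k i j * (aux_fun p n \<xi> i (Y \<omega>) * aux_fun p n \<xi> j (Y \<omega>)))"
proof -
  have int: "integrable M (\<lambda>\<omega>. k i j * (aux_fun p n \<xi> i (Y \<omega>) * aux_fun p n \<xi> j (Y \<omega>)))"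
    if "i < n" "j < n" for i j
    by (intro integrable_mult_right aux_fun_integrable that)
  then show "integrable M (\<lambda>\<omega>. \<Sum>i<n. \<Sum>j<n. k i j * (aux_fun p n \<xi> i (Y \<omega>) * aux_fun p n \<xi> j (Y \<omega>)))"
    by (intro Bochner_Integration.integrable_sum) auto
  have "?I = (\<Sum>i<n. \<integral>\<omega>. (\<Sum>j<n. k i j * (aux_fun p n \<xi> i (Y \<omega>) * aux_fun p n \<xi> j (Y \<omega>))) \<partial>M)"
    using int by (intro Bochner_Integration.integral_sum Bochner_Integration.integrable_sum) auto
  also have "\<dots> = (\<Sum>i<n. \<Sum>j<n. \<integral>\<omega>. k i j * (aux_fun p n \<xi> i (Y \<omega>) * aux_fun p n \<xi> j (Y \<omega>)) \<partial>M)"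
    using int by (intro sum.cong refl Bochner_Integration.integral_sum) auto
  also have "\<dots> = (\<Sum>i<n. \<Sum>j<n. k i j * G $$ (i, j))"
    by (intro sum.cong refl) (simp add: moment_mat_def)
  finally show "?I = (\<Sum>i<n. \<Sum>j<n. k i j * G $$ (i, j))" .
qed

lemma moment_mat_quadratic_form:
  "(\<Sum>i<n. \<Sum>j<n. c i * c j * G $$ (i, j)) = (\<integral>\<omega>. (\<Sum>i<n. c i * aux_fun p n \<xi> i (Y \<omega>))\<^sup>2 \<partial>M)"
  unfolding power2_eq_square sum_product
  by (subst aux_fun_double_sum_integral[symmetric]) (simp add: mult_ac)

lemma is_cholesky_moment_mat: "is_cholesky G Q"
proof (rule is_cholesky_cholesky)
  show "G \<in> carrier_mat n n" by (simp add: moment_mat_def)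
  show "G $$ (i, j) = G $$ (j, i)" if "i < n" "j < n" for i j
    using that by (simp add: moment_mat_def mult.commute)
  fix c :: "nat \<Rightarrow> real" assume "\<exists>i<n. c i \<noteq> 0"
  then obtain i where i: "i < n" "c i \<noteq> 0" by blast
  let ?g = "\<lambda>\<omega>. (\<Sum>i<n. c i * aux_fun p n \<xi> i (Y \<omega>))\<^sup>2"
  have int: "integrable M ?g"
    using aux_fun_double_sum_integrable[of "\<lambda>i j. c i * c j"]
    by (simp add: power2_eq_square sum_product mult_ac)
  have "(\<integral>\<omega>. ?g \<omega> \<partial>M) \<noteq> 0"
  proof
    assume "(\<integral>\<omega>. ?g \<omega> \<partial>M) = 0"
    then have "AE \<omega> in M. ?g \<omega> = 0"
      by (subst (asm) integral_nonneg_eq_0_iff_AE[OF int]) auto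
    then have "AE \<omega> in M. (\<Sum>i<n. c i * aux_fun p n \<xi> i (Y \<omega>)) = 0" by simp
    from aux_linear_independent[OF this i(1)] i(2) show False by simp
  qed
  moreover have "0 \<le> (\<integral>\<omega>. ?g \<omega> \<partial>M)" by simp
  ultimately show "0 < (\<Sum>i<n. \<Sum>j<n. c i * c j * G $$ (i, j))"
    unfolding moment_mat_quadratic_form by linarith
qed

abbreviation "\<psi> \<equiv> on_bspline M Y p n \<xi>"

abbreviation "R \<equiv> the (mat_inverse Q)"

text \<open>
  The functions \<open>\<psi>\<close> and the auxiliary ones determine each other through the mutually inverse matrices
  \<open>R\<close> and \<open>Q\<close>; later arguments use these sums instead of matrix products.
\<close>

lemma on_bspline_expansions:
  shows "R \<in> carrier_mat n n" "R * Q = 1\<^sub>m n"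
    and "\<And>i x. i \<in> {1..n} \<Longrightarrow> \<psi> i x = (\<Sum>j<n. R $$ (i - 1, j) * aux_fun p n \<xi> j x)"
    and "\<And>j x. j < n \<Longrightarrow> aux_fun p n \<xi> j x = (\<Sum>i<n. Q $$ (j, i) * \<psi> (i + 1) x)"
proof -
  have G: "G \<in> carrier_mat n n" by (simp add: moment_mat_def)
  have Q: "Q \<in> carrier_mat n n" "upper_triangular (transpose_mat Q)" "\<And>i. i < n \<Longrightarrow> 0 < Q $$ (i, i)"
    using is_cholesky_moment_mat G by (auto simp: is_cholesky_def)
  have tri: "Q $$ (i, j) = 0" if "i < j" "j < n" for i j
    using upper_triangularD[OF Q(2) that(1)] that Q(1) by auto
  obtain R' where R': "mat_inverse Q = Some R'" "R' \<in> carrier_mat n n" "Q * R' = 1\<^sub>m n" "R' * Q = 1\<^sub>m n"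
    by (rule lower_triangular_mat_inverse[OF Q(1,3) tri])
  have R: "R \<in> carrier_mat n n" "Q * R = 1\<^sub>m n" "R * Q = 1\<^sub>m n"
    using R' by simp_all
  show "R \<in> carrier_mat n n" "R * Q = 1\<^sub>m n" by (fact R)+
  have av: "aux_vec p n \<xi> x \<in> carrier_vec n" for x by (simp add: aux_vec_def)
  have psi: "\<psi> i x = vec_index (R *\<^sub>v aux_vec p n \<xi> x) (i - 1)" for i x
    by (simp add: on_bspline_def)
  show "\<psi> i x = (\<Sum>j<n. R $$ (i - 1, j) * aux_fun p n \<xi> j x)" if "i \<in> {1..n}" for i x
    using that R(1) av[of x] unfolding psi
    by (auto simp: scalar_prod_def atLeast0LessThan intro!: sum.cong)
  fix j x assume j: "j < n"
  have "Q *\<^sub>v (R *\<^sub>v aux_vec p n \<xi> x) = aux_vec p n \<xi> x"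
    using assoc_mult_mat_vec[OF Q(1) R(1) av[of x]] R(2) av[of x] by simp
  then have "aux_fun p n \<xi> j x = vec_index (Q *\<^sub>v (R *\<^sub>v aux_vec p n \<xi> x)) j" by simp
  also have "\<dots> = (\<Sum>i<n. Q $$ (j, i) * \<psi> (i + 1) x)"
    using j Q(1) R(1) av[of x] unfolding psi
    by (auto simp: scalar_prod_def[of _ "R *\<^sub>v aux_vec p n \<xi> x"] atLeast0LessThan intro!: sum.cong)
  finally show "aux_fun p n \<xi> j x = (\<Sum>i<n. Q $$ (j, i) * \<psi> (i + 1) x)" .
qed

lemma on_bspline_measurable [measurable]:
  assumes "i \<in> {1..n}" shows "\<psi> i \<in> borel_measurable borel"
proof -
  note R = on_bspline_expansions
  have eq: "\<psi> i = (\<lambda>x. \<Sum>j<n. R $$ (i - 1, j) * aux_fun p n \<xi> j x)"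
    by (rule ext) (rule R(3)[OF assms])
  show ?thesis unfolding eq by simp
qed

lemma on_bspline_bounded:
  assumes "i \<in> {1..n}" obtains C where "\<And>x. \<bar>\<psi> i x\<bar> \<le> C"
proof -
  note R = on_bspline_expansions
  have "\<bar>\<psi> i x\<bar> \<le> (\<Sum>j<n. \<bar>R $$ (i - 1, j)\<bar>)" for x
    unfolding R(3)[OF assms]
    by (rule order_trans[OF sum_abs sum_mono])
       (use aux_fun_bound in \<open>auto simp: abs_mult intro!: mult_left_le\<close>)
  then show thesis using that by blast
qed

text \<open>
  The moment matrix of \<open>\<psi>\<close> is \<open>R G R\<^sup>T = (R Q) (R Q)\<^sup>T\<close>, the identity.
\<close>

lemma on_bspline_orthonormal:
  assumes i: "i \<in> {1..n}" and j: "j \<in> {1..n}"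
  shows "(\<integral>\<omega>. \<psi> i (Y \<omega>) * \<psi> j (Y \<omega>) \<partial>M) = of_bool (i = j)"
proof -
  note R = on_bspline_expansions
  have G: "G \<in> carrier_mat n n" by (simp add: moment_mat_def)
  have Q: "Q \<in> carrier_mat n n" "G = Q * transpose_mat Q"
    using is_cholesky_moment_mat G by (auto simp: is_cholesky_def)
  have "R * G * transpose_mat R = (R * Q) * (transpose_mat Q * transpose_mat R)"
    using R(1) Q(1) by (subst Q(2)) (simp add: assoc_mult_mat[of _ n n _ n _ n])
  also have "transpose_mat Q * transpose_mat R = transpose_mat (R * Q)"
    using R(1) Q(1) by (simp add: transpose_mult[of _ n n _ n])
  finally have RGR: "R * G * transpose_mat R = 1\<^sub>m n" by (simp add: R(2))
  have "(\<integral>\<omega>. \<psi> i (Y \<omega>) * \<psi> j (Y \<omega>) \<partial>M) = (\<integral>\<omega>. (\<Sum>k<n. \<Sum>l<n. (R $$ (i - 1, k) * R $$ (j - 1, l)) *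
      (aux_fun p n \<xi> k (Y \<omega>) * aux_fun p n \<xi> l (Y \<omega>))) \<partial>M)"
    by (simp add: R(3)[OF i] R(3)[OF j] sum_product mult_ac)
  also have "\<dots> = (\<Sum>k<n. \<Sum>l<n. (R $$ (i - 1, k) * R $$ (j - 1, l)) * G $$ (k, l))"
    by (rule aux_fun_double_sum_integral)
  also have "\<dots> = (\<Sum>l<n. (\<Sum>k<n. R $$ (i - 1, k) * G $$ (k, l)) * R $$ (j - 1, l))"
    unfolding sum_distrib_right by (subst sum.swap) (intro sum.cong refl, simp add: mult_ac)
  also have "\<dots> = (R * G * transpose_mat R) $$ (i - 1, j - 1)"
  proof -
    have RG: "R * G \<in> carrier_mat n n" using R(1) G by simp
    have "(\<Sum>k<n. R $$ (i - 1, k) * G $$ (k, l)) = (R * G) $$ (i - 1, l)" if "l < n" for l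
      using i that R(1) G by (auto simp: scalar_prod_def atLeast0LessThan intro!: sum.cong)
    then show ?thesis
      using i j R(1) RG by (auto simp: scalar_prod_def atLeast0LessThan simp del: assoc_mult_mat intro!: sum.cong)
  qed
  also have "\<dots> = of_bool (i = j)" unfolding RGR using i j by auto
  finally show ?thesis .
qed

text \<open>
  The first row of the lower triangular matrix \<open>Q\<close> has only its diagonal entry, so \<open>\<psi> 1\<close> is a positive
  constant, and it is normalized.
\<close>

lemma on_bspline_1: "\<psi> 1 x = 1"
proof -
  have n: "n > 0" using open_knots_degree[OF knots ab] by simp
  have G: "G \<in> carrier_mat n n" by (simp add: moment_mat_def)
  have Q: "Q \<in> carrier_mat n n" "upper_triangular (transpose_mat Q)" "0 < Q $$ (0, 0)"
    using is_cholesky_moment_mat G n by (auto simp: is_cholesky_def)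
  have row: "Q $$ (0, j) = 0" if "0 < j" "j < n" for j
    using upper_triangularD[OF Q(2) that(1)] that Q(1) by auto
  note R = on_bspline_expansions
  have P: "1 = Q $$ (0, 0) * \<psi> 1 x" for x
  proof -
    have "1 = (\<Sum>i<n. Q $$ (0, i) * \<psi> (i + 1) x)"
      using R(4)[OF n, of x] aux_fun_eq[OF n, of p \<xi> x] by simp
    also have "\<dots> = (\<Sum>i<n. if i = 0 then Q $$ (0, 0) * \<psi> 1 x else 0)"
      by (rule sum.cong) (use row in auto)
    finally show ?thesis using n by simp
  qed
  then have psi: "\<psi> 1 x = 1 / Q $$ (0, 0)" for x
    using P[of x] Q(3) by (simp add: field_simps)
  have "(\<integral>\<omega>. \<psi> 1 (Y \<omega>) * \<psi> 1 (Y \<omega>) \<partial>M) = of_bool ((1 :: nat) = 1)"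
    using n by (intro on_bspline_orthonormal) auto
  then have "(1 / Q $$ (0, 0))\<^sup>2 = 1\<^sup>2" unfolding psi by (simp add: prob_space power2_eq_square)
  then have "1 / Q $$ (0, 0) = 1" using Q(3) by (subst (asm) power2_eq_iff_nonneg) auto
  then show ?thesis using psi by simp
qed

text \<open>
  The space spanned by the \<open>\<psi>\<close> contains \<open>B\<^sub>1\<close>, which is missing among the auxiliary functions, because
  \<open>B\<^sub>1 = 1 - B\<^sub>2 - \<dots> - B\<^sub>n\<close> on \<open>[a, b)\<close>.
\<close>

lemma spline_on_bspline_expansion:
  obtains e where "\<And>x. x \<in> {a..<b} \<Longrightarrow> (\<Sum>i = 1..n. d i * bspline \<xi> p i x) = (\<Sum>i = 1..n. e i * \<psi> i x)"
proof -
  have n: "n > 0" using open_knots_degree[OF knots ab] by simp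
  note R = on_bspline_expansions
  note P = R(4)
  define c where "c j = (if j = 0 then d 1 else d (j + 1) - d 1)" for j
  have "(\<Sum>i = 1..n. d i * bspline \<xi> p i x) = (\<Sum>i = 1..n. (\<Sum>j<n. c j * Q $$ (j, i - 1)) * \<psi> i x)"
    if x: "x \<in> {a..<b}" for x
  proof -
    have "(\<Sum>i = 1..n. d i * bspline \<xi> p i x) =
        (\<Sum>i = 1..n. d 1 * bspline \<xi> p i x + (d i - d 1) * bspline \<xi> p i x)"
      by (simp flip: distrib_right)
    also have "\<dots> = d 1 * (\<Sum>i = 1..n. bspline \<xi> p i x) + (\<Sum>i = 1..n. (d i - d 1) * bspline \<xi> p i x)"
      by (simp add: sum.distrib sum_distrib_left)
    also have "(\<Sum>i = 1..n. bspline \<xi> p i x) = 1"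
      using open_knots_partition_of_unity[OF knots ab x] .
    also have "(\<Sum>i = 1..n. (d i - d 1) * bspline \<xi> p i x) = (\<Sum>i<n. (d (i + 1) - d 1) * bspline \<xi> p (i + 1) x)"
      by (rule sum.reindex_bij_witness[of _ "\<lambda>i. i + 1" "\<lambda>i. i - 1"]) auto
    also have "d 1 * 1 + \<dots> = (\<Sum>i<n. (if i = 0 then d 1 else 0) + (d (i + 1) - d 1) * bspline \<xi> p (i + 1) x)"
      using n by (simp add: sum.distrib)
    also have "\<dots> = (\<Sum>j<n. c j * aux_fun p n \<xi> j x)"
      by (rule sum.cong) (auto simp: c_def aux_fun_eq)
    also have "\<dots> = (\<Sum>j<n. \<Sum>i<n. c j * Q $$ (j, i) * \<psi> (i + 1) x)"
      by (intro sum.cong refl) (subst P, simp_all only: lessThan_iff sum_distrib_left mult.assoc)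
    also have "\<dots> = (\<Sum>i<n. (\<Sum>j<n. c j * Q $$ (j, i)) * \<psi> (i + 1) x)"
      by (subst sum.swap) (simp add: sum_distrib_right)
    also have "\<dots> = (\<Sum>i = 1..n. (\<Sum>j<n. c j * Q $$ (j, i - 1)) * \<psi> i x)"
      by (rule sum.reindex_bij_witness[of _ "\<lambda>i. i - 1" "\<lambda>i. i + 1"]) auto
    finally show ?thesis .
  qed
  then show thesis by (rule that)
qed

end

section \<open>Mean-square approximation and modes of convergence\<close>

lemma square_sum_le: "(x + y)\<^sup>2 \<le> 2 * x\<^sup>2 + 2 * (y :: real)\<^sup>2"
  using sum_squares_bound[of x y] by (simp add: power2_sum)

context prob_space
begin

definition L2 :: "('a \<Rightarrow> real) set" where
  "L2 = {g \<in> borel_measurable M. integrable M (\<lambda>\<omega>. (g \<omega>)\<^sup>2)}"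

lemma L2_measurable: "g \<in> L2 \<Longrightarrow> g \<in> borel_measurable M"
  and L2_square_integrable: "g \<in> L2 \<Longrightarrow> integrable M (\<lambda>\<omega>. (g \<omega>)\<^sup>2)"
  by (simp_all add: L2_def)

lemma L2_bounded:
  assumes "g \<in> borel_measurable M" "AE \<omega> in M. \<bar>g \<omega>\<bar> \<le> C"
  shows "g \<in> L2"
proof -
  note [measurable] = assms(1)
  have "AE \<omega> in M. norm ((g \<omega>)\<^sup>2) \<le> C\<^sup>2"
    using assms(2) by eventually_elim (metis abs_ge_zero norm_power power2_abs power_mono real_norm_def)
  then have "integrable M (\<lambda>\<omega>. (g \<omega>)\<^sup>2)" by (intro integrable_const_bound[of _ "C\<^sup>2"]) auto
  then show ?thesis using assms(1) by (simp add: L2_def)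
qed

lemma L2_add:
  assumes "g \<in> L2" "h \<in> L2"
  shows "(\<lambda>\<omega>. g \<omega> + h \<omega>) \<in> L2"
proof -
  note [measurable] = assms[THEN L2_measurable]
  have "integrable M (\<lambda>\<omega>. 2 * (g \<omega>)\<^sup>2 + 2 * (h \<omega>)\<^sup>2)"
    using assms[THEN L2_square_integrable] by simp
  then have "integrable M (\<lambda>\<omega>. (g \<omega> + h \<omega>)\<^sup>2)"
    by (rule Bochner_Integration.integrable_bound) (use square_sum_le in auto)
  then show ?thesis by (simp add: L2_def)
qed

lemma L2_scale: "g \<in> L2 \<Longrightarrow> (\<lambda>\<omega>. c * g \<omega>) \<in> L2"
  by (auto simp: L2_def power_mult_distrib)

lemma L2_diff: "g \<in> L2 \<Longrightarrow> h \<in> L2 \<Longrightarrow> (\<lambda>\<omega>. g \<omega> - h \<omega>) \<in> L2"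
  using L2_add[of g "\<lambda>\<omega>. - 1 * h \<omega>"] L2_scale[of h "- 1"] by simp

lemma L2_sum:
  assumes "finite J" "\<And>j. j \<in> J \<Longrightarrow> g j \<in> L2"
  shows "(\<lambda>\<omega>. \<Sum>j\<in>J. g j \<omega>) \<in> L2"
  using assms
proof (induction J)
  case empty
  then show ?case by (simp add: L2_def)
qed (use L2_add in auto)

lemma L2_mult_integrable:
  assumes "g \<in> L2" "h \<in> L2"
  shows "integrable M (\<lambda>\<omega>. g \<omega> * h \<omega>)"
proof -
  note [measurable] = assms[THEN L2_measurable]
  have "integrable M (\<lambda>\<omega>. (g \<omega>)\<^sup>2 + (h \<omega>)\<^sup>2)"
    using assms[THEN L2_square_integrable] by simp
  then show ?thesis
  proof (rule Bochner_Integration.integrable_bound)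
    show "AE \<omega> in M. norm (g \<omega> * h \<omega>) \<le> norm ((g \<omega>)\<^sup>2 + (h \<omega>)\<^sup>2)"
    proof (rule AE_I2)
      fix \<omega>
      have "2 * (\<bar>g \<omega>\<bar> * \<bar>h \<omega>\<bar>) \<le> (g \<omega>)\<^sup>2 + (h \<omega>)\<^sup>2"
        using sum_squares_bound[of "\<bar>g \<omega>\<bar>" "\<bar>h \<omega>\<bar>"] by simp
      moreover have "0 \<le> \<bar>g \<omega>\<bar> * \<bar>h \<omega>\<bar>" by simp
      ultimately show "norm (g \<omega> * h \<omega>) \<le> norm ((g \<omega>)\<^sup>2 + (h \<omega>)\<^sup>2)"
        unfolding real_norm_def abs_mult by linarith
    qed
  qed simp
qed

lemma L2_add_expectation_le:
  assumes "g \<in> L2" "h \<in> L2"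
  shows "expectation (\<lambda>\<omega>. (g \<omega> + h \<omega>)\<^sup>2) \<le> 2 * expectation (\<lambda>\<omega>. (g \<omega>)\<^sup>2) + 2 * expectation (\<lambda>\<omega>. (h \<omega>)\<^sup>2)"
proof -
  have "expectation (\<lambda>\<omega>. (g \<omega> + h \<omega>)\<^sup>2) \<le> expectation (\<lambda>\<omega>. 2 * (g \<omega>)\<^sup>2 + 2 * (h \<omega>)\<^sup>2)"
    using assms[THEN L2_square_integrable] L2_add[OF assms, THEN L2_square_integrable]
    by (intro integral_mono square_sum_le) auto
  then show ?thesis using assms[THEN L2_square_integrable] by simp
qed

text \<open>
  Expanding the square shows that the error of the coefficients \<open>d\<close> exceeds the error of the
  coefficients \<open>c j = E(g e\<^sub>j)\<close> by exactly the sum of the \<open>(d j - c j)\<^sup>2\<close>.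
\<close>

lemma orthogonal_projection_optimal:
  assumes J: "finite J" and e: "\<And>j. j \<in> J \<Longrightarrow> e j \<in> L2"
    and orth: "\<And>i j. i \<in> J \<Longrightarrow> j \<in> J \<Longrightarrow> expectation (\<lambda>\<omega>. e i \<omega> * e j \<omega>) = of_bool (i = j)"
    and g: "g \<in> L2"
  shows "expectation (\<lambda>\<omega>. (g \<omega> - (\<Sum>j\<in>J. expectation (\<lambda>\<omega>. g \<omega> * e j \<omega>) * e j \<omega>))\<^sup>2)
     \<le> expectation (\<lambda>\<omega>. (g \<omega> - (\<Sum>j\<in>J. d j * e j \<omega>))\<^sup>2)"
proof -
  define c where "c j = expectation (\<lambda>\<omega>. g \<omega> * e j \<omega>)" for j
  have *: "expectation (\<lambda>\<omega>. (g \<omega> - (\<Sum>j\<in>J. d j * e j \<omega>))\<^sup>2)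
    = expectation (\<lambda>\<omega>. (g \<omega>)\<^sup>2) - (\<Sum>j\<in>J. (c j)\<^sup>2) + (\<Sum>j\<in>J. (d j - c j)\<^sup>2)" for d
  proof -
    let ?s = "\<lambda>\<omega>. \<Sum>j\<in>J. d j * e j \<omega>"
    have s: "?s \<in> L2" using J e by (intro L2_sum L2_scale)
    have gs: "expectation (\<lambda>\<omega>. g \<omega> * ?s \<omega>) = (\<Sum>j\<in>J. d j * c j)"
    proof -
      have "expectation (\<lambda>\<omega>. g \<omega> * ?s \<omega>) = expectation (\<lambda>\<omega>. \<Sum>j\<in>J. d j * (g \<omega> * e j \<omega>))"
        by (simp add: sum_distrib_left mult_ac)
      also have "\<dots> = (\<Sum>j\<in>J. expectation (\<lambda>\<omega>. d j * (g \<omega> * e j \<omega>)))"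
        by (intro Bochner_Integration.integral_sum integrable_mult_right L2_mult_integrable g e)
      finally show ?thesis by (simp add: c_def)
    qed
    have ss: "expectation (\<lambda>\<omega>. ?s \<omega> * ?s \<omega>) = (\<Sum>j\<in>J. (d j)\<^sup>2)"
    proof -
      have "expectation (\<lambda>\<omega>. ?s \<omega> * ?s \<omega>) = expectation (\<lambda>\<omega>. \<Sum>i\<in>J. \<Sum>j\<in>J. (d i * d j) * (e i \<omega> * e j \<omega>))"
        by (simp add: sum_product mult_ac)
      also have "\<dots> = (\<Sum>i\<in>J. expectation (\<lambda>\<omega>. \<Sum>j\<in>J. (d i * d j) * (e i \<omega> * e j \<omega>)))"
        by (intro Bochner_Integration.integral_sum Bochner_Integration.integrable_sum integrable_mult_right L2_mult_integrable e)
      also have "\<dots> = (\<Sum>i\<in>J. \<Sum>j\<in>J. expectation (\<lambda>\<omega>. (d i * d j) * (e i \<omega> * e j \<omega>)))"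
        by (intro sum.cong refl Bochner_Integration.integral_sum integrable_mult_right L2_mult_integrable e)
      also have "\<dots> = (\<Sum>i\<in>J. \<Sum>j\<in>J. if j = i then (d i)\<^sup>2 else 0)"
        by (intro sum.cong refl) (simp add: orth power2_eq_square)
      finally show ?thesis using J by simp
    qed
    have "expectation (\<lambda>\<omega>. (g \<omega> - ?s \<omega>)\<^sup>2) = expectation (\<lambda>\<omega>. (g \<omega>)\<^sup>2 - 2 * (g \<omega> * ?s \<omega>) + ?s \<omega> * ?s \<omega>)"
      by (simp add: power2_eq_square algebra_simps)
    also have "\<dots> = expectation (\<lambda>\<omega>. (g \<omega>)\<^sup>2) - 2 * expectation (\<lambda>\<omega>. g \<omega> * ?s \<omega>) + expectation (\<lambda>\<omega>. ?s \<omega> * ?s \<omega>)"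
      using L2_square_integrable[OF g] L2_mult_integrable[OF g s] L2_mult_integrable[OF s s]
      by (simp add: Bochner_Integration.integral_add Bochner_Integration.integral_diff)
    also have "\<dots> = expectation (\<lambda>\<omega>. (g \<omega>)\<^sup>2) - (\<Sum>j\<in>J. (c j)\<^sup>2) + (\<Sum>j\<in>J. (d j - c j)\<^sup>2)"
      unfolding gs ss by (simp add: power2_diff sum.distrib sum_subtractf sum_distrib_left mult_ac)
    finally show ?thesis .
  qed
  have "0 \<le> (\<Sum>j\<in>J. (d j - c j)\<^sup>2)" by (rule sum_nonneg) simp
  then show ?thesis using *[of c] *[of d] by (simp add: c_def)
qed

text \<open>
  The functions whose distance to the spaces \<open>T m\<close> tends to zero. No element of \<open>T m\<close> is singled out,
  which makes closure under linear combinations and limits immediate.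
\<close>

definition approximable :: "(nat \<Rightarrow> ('a \<Rightarrow> real) set) \<Rightarrow> ('a \<Rightarrow> real) \<Rightarrow> bool" where
  "approximable T g \<longleftrightarrow> g \<in> L2 \<and>
     (\<forall>\<epsilon>>0. \<forall>\<^sub>F m in sequentially. \<exists>s \<in> T m. expectation (\<lambda>\<omega>. (g \<omega> - s \<omega>)\<^sup>2) < \<epsilon>)"

lemma approximableD:
  "approximable T g \<Longrightarrow> \<epsilon> > 0 \<Longrightarrow>
     \<forall>\<^sub>F m in sequentially. \<exists>s \<in> T m. expectation (\<lambda>\<omega>. (g \<omega> - s \<omega>)\<^sup>2) < \<epsilon>"
  by (simp add: approximable_def)

lemma approximable_limit:
  assumes T: "\<And>m. T m \<subseteq> L2" and g: "g \<in> L2"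
    and close: "\<And>\<epsilon>. \<epsilon> > 0 \<Longrightarrow> \<exists>h. approximable T h \<and> expectation (\<lambda>\<omega>. (g \<omega> - h \<omega>)\<^sup>2) < \<epsilon>"
  shows "approximable T g"
  unfolding approximable_def
proof (intro conjI allI impI)
  fix \<epsilon> :: real assume "\<epsilon> > 0"
  then obtain h where h: "approximable T h" "expectation (\<lambda>\<omega>. (g \<omega> - h \<omega>)\<^sup>2) < \<epsilon> / 4"
    using close[of "\<epsilon> / 4"] by auto
  then have hL: "h \<in> L2" by (simp add: approximable_def)
  have "\<forall>\<^sub>F m in sequentially. \<exists>s \<in> T m. expectation (\<lambda>\<omega>. (h \<omega> - s \<omega>)\<^sup>2) < \<epsilon> / 4"
    using h(1) by (rule approximableD) (use \<open>\<epsilon> > 0\<close> in simp)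
  then show "\<forall>\<^sub>F m in sequentially. \<exists>s \<in> T m. expectation (\<lambda>\<omega>. (g \<omega> - s \<omega>)\<^sup>2) < \<epsilon>"
  proof eventually_elim
    case (elim m)
    then obtain s where s: "s \<in> T m" "expectation (\<lambda>\<omega>. (h \<omega> - s \<omega>)\<^sup>2) < \<epsilon> / 4" by blast
    have sL: "s \<in> L2" using s T by blast
    have "expectation (\<lambda>\<omega>. (g \<omega> - s \<omega>)\<^sup>2) = expectation (\<lambda>\<omega>. ((g \<omega> - h \<omega>) + (h \<omega> - s \<omega>))\<^sup>2)"
      by simp
    also have "\<dots> \<le> 2 * expectation (\<lambda>\<omega>. (g \<omega> - h \<omega>)\<^sup>2) + 2 * expectation (\<lambda>\<omega>. (h \<omega> - s \<omega>)\<^sup>2)"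
      by (intro L2_add_expectation_le L2_diff g hL sL)
    also have "\<dots> < \<epsilon>" using h(2) s(2) by linarith
    finally show ?case using s(1) by blast
  qed
qed (rule g)

lemma approximable_cong:
  assumes "\<And>\<omega>. \<omega> \<in> space M \<Longrightarrow> g \<omega> = h \<omega>"
  shows "approximable T g \<longleftrightarrow> approximable T h"
proof -
  have "g \<in> borel_measurable M \<longleftrightarrow> h \<in> borel_measurable M"
    by (rule measurable_cong) (rule assms)
  moreover have "integrable M (\<lambda>\<omega>. (g \<omega>)\<^sup>2) \<longleftrightarrow> integrable M (\<lambda>\<omega>. (h \<omega>)\<^sup>2)"
    by (rule Bochner_Integration.integrable_cong) (simp_all add: assms)
  moreover have "expectation (\<lambda>\<omega>. (g \<omega> - s \<omega>)\<^sup>2) = expectation (\<lambda>\<omega>. (h \<omega> - s \<omega>)\<^sup>2)" for s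
    by (rule Bochner_Integration.integral_cong) (simp_all add: assms)
  ultimately show ?thesis by (simp add: approximable_def L2_def)
qed

text \<open>
  The form in which closedness is applied: by dominated convergence, dominated pointwise limits are
  mean-square limits.
\<close>

lemma approximable_pointwise_limit:
  assumes T: "\<And>m. T m \<subseteq> L2" and g: "g \<in> borel_measurable M" and h: "\<And>i. approximable T (h i)"
    and w: "w \<in> L2" and bound: "\<And>i \<omega>. \<omega> \<in> space M \<Longrightarrow> \<bar>g \<omega> - h i \<omega>\<bar> \<le> \<bar>w \<omega>\<bar>"
    and lim: "\<And>\<omega>. \<omega> \<in> space M \<Longrightarrow> (\<lambda>i. h i \<omega>) \<longlonglongrightarrow> g \<omega>"
  shows "approximable T g"
proof (rule approximable_limit[OF T])
  have hL: "h i \<in> L2" for i using h[of i] by (simp add: approximable_def)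
  note [measurable] = g hL[THEN L2_measurable]
  have sq: "(g \<omega> - h i \<omega>)\<^sup>2 \<le> (w \<omega>)\<^sup>2" if "\<omega> \<in> space M" for i \<omega>
    using bound[OF that] by (simp add: abs_le_square_iff)
  have "integrable M (\<lambda>\<omega>. (g \<omega> - h 0 \<omega>)\<^sup>2)"
    by (rule Bochner_Integration.integrable_bound[OF L2_square_integrable[OF w]]) (use sq in \<open>auto intro!: AE_I2\<close>)
  then have "(\<lambda>\<omega>. g \<omega> - h 0 \<omega>) \<in> L2" by (simp add: L2_def)
  from L2_add[OF this hL[of 0]] show "g \<in> L2" by simp
  have "(\<lambda>i. expectation (\<lambda>\<omega>. (g \<omega> - h i \<omega>)\<^sup>2)) \<longlonglongrightarrow> expectation (\<lambda>\<omega>. 0)"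
  proof (rule integral_dominated_convergence[where w = "\<lambda>\<omega>. (w \<omega>)\<^sup>2"])
    show "integrable M (\<lambda>\<omega>. (w \<omega>)\<^sup>2)" by (rule L2_square_integrable[OF w])
    show "AE \<omega> in M. norm ((g \<omega> - h i \<omega>)\<^sup>2) \<le> (w \<omega>)\<^sup>2" for i
      using sq by (auto intro!: AE_I2)
    show "AE \<omega> in M. (\<lambda>i. (g \<omega> - h i \<omega>)\<^sup>2) \<longlonglongrightarrow> 0"
    proof (rule AE_I2)
      fix \<omega> assume "\<omega> \<in> space M"
      then have "(\<lambda>i. (g \<omega> - h i \<omega>)\<^sup>2) \<longlonglongrightarrow> (g \<omega> - g \<omega>)\<^sup>2"
        by (intro tendsto_power tendsto_diff tendsto_const lim)
      then show "(\<lambda>i. (g \<omega> - h i \<omega>)\<^sup>2) \<longlonglongrightarrow> 0" by simp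
    qed
  qed simp_all
  then have lim': "(\<lambda>i. expectation (\<lambda>\<omega>. (g \<omega> - h i \<omega>)\<^sup>2)) \<longlonglongrightarrow> 0" by simp
  fix \<epsilon> :: real assume "\<epsilon> > 0"
  then have "\<forall>\<^sub>F i in sequentially. expectation (\<lambda>\<omega>. (g \<omega> - h i \<omega>)\<^sup>2) < \<epsilon>"
    using lim' by (intro order_tendstoD(2))
  then obtain i where "expectation (\<lambda>\<omega>. (g \<omega> - h i \<omega>)\<^sup>2) < \<epsilon>"
    by (auto simp: eventually_sequentially)
  then show "\<exists>h. approximable T h \<and> expectation (\<lambda>\<omega>. (g \<omega> - h \<omega>)\<^sup>2) < \<epsilon>"
    using h by blast
qed

lemma approximable_add:
  assumes T: "\<And>m. T m \<subseteq> L2" and Tadd: "\<And>m s t. s \<in> T m \<Longrightarrow> t \<in> T m \<Longrightarrow> (\<lambda>\<omega>. s \<omega> + t \<omega>) \<in> T m"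
    and g: "approximable T g" and h: "approximable T h"
  shows "approximable T (\<lambda>\<omega>. g \<omega> + h \<omega>)"
  unfolding approximable_def
proof (intro conjI allI impI)
  have gh: "g \<in> L2" "h \<in> L2" using g h by (auto simp: approximable_def)
  then show "(\<lambda>\<omega>. g \<omega> + h \<omega>) \<in> L2" by (rule L2_add)
  fix \<epsilon> :: real assume "\<epsilon> > 0"
  then have eps: "\<epsilon> / 4 > 0" by simp
  have "\<forall>\<^sub>F m in sequentially. \<exists>s \<in> T m. expectation (\<lambda>\<omega>. (g \<omega> - s \<omega>)\<^sup>2) < \<epsilon> / 4"
    "\<forall>\<^sub>F m in sequentially. \<exists>t \<in> T m. expectation (\<lambda>\<omega>. (h \<omega> - t \<omega>)\<^sup>2) < \<epsilon> / 4"
    by (rule approximableD[OF g eps], rule approximableD[OF h eps])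
  then show "\<forall>\<^sub>F m in sequentially. \<exists>s \<in> T m. expectation (\<lambda>\<omega>. (g \<omega> + h \<omega> - s \<omega>)\<^sup>2) < \<epsilon>"
  proof eventually_elim
    case (elim m)
    then obtain s t where s: "s \<in> T m" "expectation (\<lambda>\<omega>. (g \<omega> - s \<omega>)\<^sup>2) < \<epsilon> / 4"
      and t: "t \<in> T m" "expectation (\<lambda>\<omega>. (h \<omega> - t \<omega>)\<^sup>2) < \<epsilon> / 4" by blast
    have "expectation (\<lambda>\<omega>. (g \<omega> + h \<omega> - (s \<omega> + t \<omega>))\<^sup>2) = expectation (\<lambda>\<omega>. ((g \<omega> - s \<omega>) + (h \<omega> - t \<omega>))\<^sup>2)"
      by (simp add: algebra_simps)
    also have "\<dots> \<le> 2 * expectation (\<lambda>\<omega>. (g \<omega> - s \<omega>)\<^sup>2) + 2 * expectation (\<lambda>\<omega>. (h \<omega> - t \<omega>)\<^sup>2)"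
      using s(1) t(1) T by (intro L2_add_expectation_le L2_diff gh) blast+
    also have "\<dots> < \<epsilon>" using s(2) t(2) by linarith
    finally show ?case by (intro bexI[OF _ Tadd[OF s(1) t(1)]])
  qed
qed

lemma approximable_scale:
  assumes Tscale: "\<And>m s. s \<in> T m \<Longrightarrow> (\<lambda>\<omega>. c * s \<omega>) \<in> T m"
    and g: "approximable T g"
  shows "approximable T (\<lambda>\<omega>. c * g \<omega>)"
  unfolding approximable_def
proof (intro conjI allI impI)
  show "(\<lambda>\<omega>. c * g \<omega>) \<in> L2" using g by (auto simp: approximable_def intro: L2_scale)
  fix \<epsilon> :: real assume eps: "\<epsilon> > 0"
  have pos: "c\<^sup>2 + 1 > 0" by (simp add: add_nonneg_pos)
  have "\<forall>\<^sub>F m in sequentially. \<exists>s \<in> T m. expectation (\<lambda>\<omega>. (g \<omega> - s \<omega>)\<^sup>2) < \<epsilon> / (c\<^sup>2 + 1)"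
    using g eps pos unfolding approximable_def by auto
  then show "\<forall>\<^sub>F m in sequentially. \<exists>s \<in> T m. expectation (\<lambda>\<omega>. (c * g \<omega> - s \<omega>)\<^sup>2) < \<epsilon>"
  proof eventually_elim
    case (elim m)
    then obtain s where s: "s \<in> T m" "expectation (\<lambda>\<omega>. (g \<omega> - s \<omega>)\<^sup>2) < \<epsilon> / (c\<^sup>2 + 1)" by blast
    have "expectation (\<lambda>\<omega>. (c * g \<omega> - c * s \<omega>)\<^sup>2) = c\<^sup>2 * expectation (\<lambda>\<omega>. (g \<omega> - s \<omega>)\<^sup>2)"
      by (simp add: power_mult_distrib flip: right_diff_distrib)
    also have "\<dots> \<le> (c\<^sup>2 + 1) * expectation (\<lambda>\<omega>. (g \<omega> - s \<omega>)\<^sup>2)"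
      by (intro mult_right_mono) auto
    also have "\<dots> < \<epsilon>" using s(2) pos by (simp add: field_simps)
    finally show ?case by (intro bexI[OF _ Tscale[OF s(1)]])
  qed
qed

lemma mean_square_imp_in_probability:
  assumes D: "\<And>m. D m \<in> L2" and lim: "(\<lambda>m. expectation (\<lambda>\<omega>. (D m \<omega>)\<^sup>2)) \<longlonglongrightarrow> 0" and eps: "\<epsilon> > 0"
  shows "(\<lambda>m. prob {\<omega> \<in> space M. \<bar>D m \<omega>\<bar> > \<epsilon>}) \<longlonglongrightarrow> 0"
proof (rule tendsto_sandwich[OF _ _ tendsto_const])
  show "\<forall>\<^sub>F m in sequentially. prob {\<omega> \<in> space M. \<bar>D m \<omega>\<bar> > \<epsilon>} \<le> expectation (\<lambda>\<omega>. (D m \<omega>)\<^sup>2) / \<epsilon>\<^sup>2"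
  proof (rule always_eventually, rule allI)
    fix m
    note [measurable] = L2_measurable[OF D[of m]]
    have "prob {\<omega> \<in> space M. \<bar>D m \<omega>\<bar> > \<epsilon>} \<le> prob {\<omega> \<in> space M. (D m \<omega>)\<^sup>2 \<ge> \<epsilon>\<^sup>2}"
    proof (rule finite_measure_mono)
      show "{\<omega> \<in> space M. \<bar>D m \<omega>\<bar> > \<epsilon>} \<subseteq> {\<omega> \<in> space M. (D m \<omega>)\<^sup>2 \<ge> \<epsilon>\<^sup>2}"
        using eps by (auto simp: abs_le_square_iff[symmetric])
    qed simp
    also have "\<dots> \<le> expectation (\<lambda>\<omega>. (D m \<omega>)\<^sup>2) / \<epsilon>\<^sup>2"
      by (rule integral_Markov_inequality_measure[where A = "{}"]) (use L2_square_integrable[OF D] eps in auto)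
    finally show "prob {\<omega> \<in> space M. \<bar>D m \<omega>\<bar> > \<epsilon>} \<le> expectation (\<lambda>\<omega>. (D m \<omega>)\<^sup>2) / \<epsilon>\<^sup>2" .
  qed
  show "(\<lambda>m. expectation (\<lambda>\<omega>. (D m \<omega>)\<^sup>2) / \<epsilon>\<^sup>2) \<longlonglongrightarrow> 0"
    using tendsto_divide[OF lim tendsto_const[of "\<epsilon>\<^sup>2"]] eps by simp
qed simp

text \<open>
  Unless \<open>Z\<close> and \<open>W\<close> differ by more than \<open>\<epsilon>\<close>, the event \<open>W \<le> t\<close> lies between \<open>Z \<le> t - \<epsilon>\<close> and \<open>Z \<le> t + \<epsilon>\<close>.
\<close>

lemma distribution_function_sandwich:
  fixes Z W :: "'a \<Rightarrow> real"
  assumes [measurable]: "Z \<in> borel_measurable M" "W \<in> borel_measurable M"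
  shows "prob {\<omega> \<in> space M. W \<omega> \<le> t} \<le> prob {\<omega> \<in> space M. Z \<omega> \<le> t + \<epsilon>} + prob {\<omega> \<in> space M. \<bar>Z \<omega> - W \<omega>\<bar> > \<epsilon>}"
    and "prob {\<omega> \<in> space M. Z \<omega> \<le> t - \<epsilon>} \<le> prob {\<omega> \<in> space M. W \<omega> \<le> t} + prob {\<omega> \<in> space M. \<bar>Z \<omega> - W \<omega>\<bar> > \<epsilon>}"
proof -
  have "prob {\<omega> \<in> space M. W \<omega> \<le> t} \<le> prob ({\<omega> \<in> space M. Z \<omega> \<le> t + \<epsilon>} \<union> {\<omega> \<in> space M. \<bar>Z \<omega> - W \<omega>\<bar> > \<epsilon>})"
    by (rule finite_measure_mono) auto
  also have "\<dots> \<le> prob {\<omega> \<in> space M. Z \<omega> \<le> t + \<epsilon>} + prob {\<omega> \<in> space M. \<bar>Z \<omega> - W \<omega>\<bar> > \<epsilon>}"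
    by (rule measure_Un_le) auto
  finally show "prob {\<omega> \<in> space M. W \<omega> \<le> t} \<le> prob {\<omega> \<in> space M. Z \<omega> \<le> t + \<epsilon>} + prob {\<omega> \<in> space M. \<bar>Z \<omega> - W \<omega>\<bar> > \<epsilon>}" .
  have "prob {\<omega> \<in> space M. Z \<omega> \<le> t - \<epsilon>} \<le> prob ({\<omega> \<in> space M. W \<omega> \<le> t} \<union> {\<omega> \<in> space M. \<bar>Z \<omega> - W \<omega>\<bar> > \<epsilon>})"
    by (rule finite_measure_mono) auto
  also have "\<dots> \<le> prob {\<omega> \<in> space M. W \<omega> \<le> t} + prob {\<omega> \<in> space M. \<bar>Z \<omega> - W \<omega>\<bar> > \<epsilon>}"
    by (rule measure_Un_le) auto
  finally show "prob {\<omega> \<in> space M. Z \<omega> \<le> t - \<epsilon>} \<le> prob {\<omega> \<in> space M. W \<omega> \<le> t} + prob {\<omega> \<in> space M. \<bar>Z \<omega> - W \<omega>\<bar> > \<epsilon>}" .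
qed

text \<open>
  The set \<open>S\<close> allows one argument for both modes of convergence: a one-point set yields convergence
  at a point of continuity, the whole line yields uniform convergence. The modulus of continuity has
  to be uniform over \<open>t\<close> in \<open>S\<close>, whereas \<open>s\<close> may leave \<open>S\<close>.
\<close>

lemma in_probability_imp_in_distribution:
  fixes Z :: "'a \<Rightarrow> real" and W :: "nat \<Rightarrow> 'a \<Rightarrow> real"
  assumes Z: "Z \<in> borel_measurable M" and W: "\<And>m. W m \<in> borel_measurable M"
    and lim: "\<And>\<epsilon>. \<epsilon> > 0 \<Longrightarrow> (\<lambda>m. prob {\<omega> \<in> space M. \<bar>Z \<omega> - W m \<omega>\<bar> > \<epsilon>}) \<longlonglongrightarrow> 0"
    and cont: "\<And>e. e > 0 \<Longrightarrow> \<exists>d>0. \<forall>t \<in> S. \<forall>s. \<bar>s - t\<bar> \<le> d \<longrightarrow>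
      \<bar>prob {\<omega> \<in> space M. Z \<omega> \<le> s} - prob {\<omega> \<in> space M. Z \<omega> \<le> t}\<bar> < e"
  shows "uniform_limit S (\<lambda>m t. prob {\<omega> \<in> space M. W m \<omega> \<le> t}) (\<lambda>t. prob {\<omega> \<in> space M. Z \<omega> \<le> t}) sequentially"
proof (rule uniform_limitI)
  fix e :: real assume e: "e > 0"
  let ?F = "\<lambda>t. prob {\<omega> \<in> space M. Z \<omega> \<le> t}"
  obtain d where d: "d > 0" "\<And>t s. t \<in> S \<Longrightarrow> \<bar>s - t\<bar> \<le> d \<Longrightarrow> \<bar>?F s - ?F t\<bar> < e / 2"
    using cont[of "e / 2"] e by auto
  have "\<forall>\<^sub>F m in sequentially. prob {\<omega> \<in> space M. \<bar>Z \<omega> - W m \<omega>\<bar> > d} < e / 2"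
    using lim[OF d(1)] e by (intro order_tendstoD(2)) auto
  then show "\<forall>\<^sub>F m in sequentially. \<forall>t \<in> S. dist (prob {\<omega> \<in> space M. W m \<omega> \<le> t}) (?F t) < e"
  proof eventually_elim
    case (elim m)
    show ?case
    proof
      fix t assume t: "t \<in> S"
      have "\<bar>?F (t + d) - ?F t\<bar> < e / 2" "\<bar>?F (t - d) - ?F t\<bar> < e / 2"
        by (rule d(2)[OF t], use d(1) in simp)+
      then show "dist (prob {\<omega> \<in> space M. W m \<omega> \<le> t}) (?F t) < e"
        using distribution_function_sandwich[OF Z W[of m], of t d] elim
        unfolding dist_real_def by linarith
    qed
  qed
qed

text \<open>
  Outside a compact interval the distribution function is close to its limits \<open>0\<close> and \<open>1\<close>; on that
  interval, enlarged by \<open>1\<close> so that nearby points fall into a common case, Heine-Cantor applies.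
\<close>

lemma continuous_distribution_function_uniformly_continuous:
  fixes Z :: "'a \<Rightarrow> real"
  assumes Z: "Z \<in> borel_measurable M"
    and cont: "continuous_on UNIV (\<lambda>t. prob {\<omega> \<in> space M. Z \<omega> \<le> t})"
    and e: "(e :: real) > 0"
  shows "\<exists>d>0. \<forall>t s. \<bar>s - t\<bar> \<le> d \<longrightarrow>
      \<bar>prob {\<omega> \<in> space M. Z \<omega> \<le> s} - prob {\<omega> \<in> space M. Z \<omega> \<le> t}\<bar> < e"
proof -
  let ?F = "\<lambda>t. prob {\<omega> \<in> space M. Z \<omega> \<le> t}"
  note [measurable] = Z
  interpret D: real_distribution "distr M borel Z" by (rule real_distribution_distr) simp
  have F: "cdf (distr M borel Z) t = ?F t" for t
    unfolding cdf_def by (subst measure_distr) (auto intro!: arg_cong[of _ _ prob])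
  have F': "cdf (distr M borel Z) = ?F" using F by blast
  have "\<forall>\<^sub>F t in at_top. dist (?F t) 1 < e / 2"
    using D.cdf_lim_at_top_prob e unfolding F' by (intro tendstoD) auto
  then obtain A where A: "\<And>t. t \<ge> A \<Longrightarrow> \<bar>?F t - 1\<bar> < e / 2"
    by (auto simp: eventually_at_top_linorder dist_real_def)
  have "\<forall>\<^sub>F t in at_bot. dist (?F t) 0 < e / 2"
    using D.cdf_lim_at_bot e unfolding F' by (intro tendstoD) auto
  then obtain B where B: "\<And>t. t \<le> B \<Longrightarrow> \<bar>?F t\<bar> < e / 2"
    by (auto simp: eventually_at_bot_linorder dist_real_def)
  have "uniformly_continuous_on {B - 1..A + 1} ?F"
    using cont by (intro compact_uniformly_continuous) (auto intro: continuous_on_subset)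
  then obtain d where d: "d > 0" "\<And>s t. s \<in> {B - 1..A + 1} \<Longrightarrow> t \<in> {B - 1..A + 1} \<Longrightarrow> dist s t < d \<Longrightarrow> dist (?F s) (?F t) < e"
    using e unfolding uniformly_continuous_on_def by blast
  show ?thesis
  proof (intro exI[of _ "min (d / 2) 1"] conjI allI impI)
    show "min (d / 2) 1 > 0" using d by simp
    fix t s :: real assume st: "\<bar>s - t\<bar> \<le> min (d / 2) 1"
    then have st1: "\<bar>s - t\<bar> \<le> 1" by simp
    consider "s < A \<or> t < A" "B < s \<or> B < t" | "s \<ge> A" "t \<ge> A" | "s \<le> B" "t \<le> B"
      by (meson not_le)
    then show "\<bar>?F s - ?F t\<bar> < e"
    proof cases
      case 1
      then have "s \<in> {B - 1..A + 1}" "t \<in> {B - 1..A + 1}"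
        using st1 by (auto simp: abs_le_iff)
      moreover have "dist s t < d" using st d(1) by (simp add: dist_real_def)
      ultimately have "dist (?F s) (?F t) < e" by (rule d(2))
      then show ?thesis by (simp only: dist_real_def)
    next
      case 2
      show ?thesis using A[OF 2(1)] A[OF 2(2)] by linarith
    next
      case 3
      show ?thesis using B[OF 3(1)] B[OF 3(2)] by linarith
    qed
  qed
qed

end

section \<open>Tensor products and the orthogonal projection\<close>

lemma space_input_space: "space (input_space N a b) = (\<Pi>\<^sub>E k\<in>{1..N}. {a k..b k})"
  by (simp add: input_space_def space_PiM space_restrict_space)

text \<open>
  A generator of the \<open>\<sigma>\<close>-algebra of the input space that is stable under intersection and consists of
  the sets whose indicators the products of step splines approximate.
\<close>

definition lower_boxes :: "nat \<Rightarrow> (nat \<Rightarrow> real) \<Rightarrow> (nat \<Rightarrow> real) \<Rightarrow> (nat \<Rightarrow> real) set set" where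
  "lower_boxes N a b = range (\<lambda>c. {x \<in> space (input_space N a b). \<forall>k\<in>{1..N}. x k \<le> c k})"

lemma Int_stable_lower_boxes: "Int_stable (lower_boxes N a b)"
proof (rule Int_stableI)
  fix A B assume "A \<in> lower_boxes N a b" "B \<in> lower_boxes N a b"
  then obtain c d where "A = {x \<in> space (input_space N a b). \<forall>k\<in>{1..N}. x k \<le> c k}"
    "B = {x \<in> space (input_space N a b). \<forall>k\<in>{1..N}. x k \<le> d k}" by (auto simp: lower_boxes_def)
  then have "A \<inter> B = {x \<in> space (input_space N a b). \<forall>k\<in>{1..N}. x k \<le> min (c k) (d k)}" by auto
  then show "A \<inter> B \<in> lower_boxes N a b"
    unfolding lower_boxes_def by (rule range_eqI[of _ _ "\<lambda>k. min (c k) (d k)"])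
qed

lemma sets_input_space_le_lower_boxes:
  "sets (input_space N a b) \<subseteq> sigma_sets (space (input_space N a b)) (lower_boxes N a b)"
proof -
  let ?\<Omega> = "space (input_space N a b)"
  define S where "S = sigma ?\<Omega> (lower_boxes N a b)"
  have sub: "lower_boxes N a b \<subseteq> Pow ?\<Omega>" by (auto simp: lower_boxes_def)
  have sets_S: "sets S = sigma_sets ?\<Omega> (lower_boxes N a b)" by (simp add: S_def sub)
  have space_S: "space S = ?\<Omega>" by (simp add: S_def space_measure_of[OF sub])
  have range: "x k \<in> {a k..b k}" if "x \<in> space S" "k \<in> {1..N}" for x k
    using that unfolding space_S space_input_space by (rule PiE_mem)
  have "(\<lambda>x k. x k) \<in> measurable S (PiM {1..N} (\<lambda>k. restrict_space borel {a k..b k}))"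
  proof (rule measurable_PiM_single')
    show "(\<lambda>x k. x k) \<in> space S \<rightarrow> (\<Pi>\<^sub>E k\<in>{1..N}. space (restrict_space borel {a k..b k}))"
      unfolding space_S space_input_space by (simp add: space_restrict_space)
    fix k assume k: "k \<in> {1..N}"
    show "(\<lambda>x. x k) \<in> measurable S (restrict_space borel {a k..b k})"
    proof (rule measurable_restrict_space2)
      show "(\<lambda>x. x k) \<in> space S \<rightarrow> {a k..b k}" using range[OF _ k] by blast
      show "(\<lambda>x. x k) \<in> borel_measurable S"
        unfolding borel_measurable_iff_le
      proof
        fix c
        \<comment> \<open>The range is bounded above by \<open>b\<close>, so a condition on one coordinate is a box as well.\<close>
        have "{x \<in> space S. x k \<le> c} = {x \<in> ?\<Omega>. \<forall>j\<in>{1..N}. x j \<le> (if j = k then c else b j)}"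
          using k range by (auto simp: space_S)
        also have "\<dots> \<in> lower_boxes N a b" unfolding lower_boxes_def by (rule rangeI)
        finally show "{x \<in> space S. x k \<le> c} \<in> sets S" by (simp add: sets_S sigma_sets.Basic)
      qed
    qed
  qed
  then have id: "(\<lambda>x. x) \<in> measurable S (input_space N a b)" by (simp add: input_space_def)
  show ?thesis
  proof
    fix A assume A: "A \<in> sets (input_space N a b)"
    from measurable_sets[OF id A] have "?\<Omega> \<inter> A \<in> sigma_sets ?\<Omega> (lower_boxes N a b)"
      by (simp add: sets_S space_S vimage_def Int_def conj_commute)
    moreover have "?\<Omega> \<inter> A = A" using sets.sets_into_space[OF A] by auto
    ultimately show "A \<in> sigma_sets ?\<Omega> (lower_boxes N a b)" by simp
  qed
qed

text \<open>
  The data of the theorem except for the function \<open>y\<close>.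
\<close>

locale spline_family =
  fixes M :: "'a measure" and N :: nat and a b :: "nat \<Rightarrow> real"
    and X :: "nat \<Rightarrow> 'a \<Rightarrow> real" and f :: "nat \<Rightarrow> real \<Rightarrow> real" and p :: "nat \<Rightarrow> nat"
    and n :: "nat \<Rightarrow> nat \<Rightarrow> nat" and \<xi> :: "nat \<Rightarrow> nat \<Rightarrow> nat \<Rightarrow> real"
  assumes standing: "standing_assumptions M N a b X f"
    and knots: "\<And>m k. k \<in> {1..N} \<Longrightarrow> open_knots (a k) (b k) (p k) (n m k) (\<xi> m k)"
    and mesh: "\<And>k. k \<in> {1..N} \<Longrightarrow> (\<lambda>m. largest_element (p k) (n m k) (\<xi> m k)) \<longlonglongrightarrow> 0"
begin

sublocale prob_space M using standing by (simp add: standing_assumptions_def)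

abbreviation "RV \<equiv> random_vec N X"
abbreviation "K \<equiv> input_space N a b"

lemma random_vec_measurable [measurable]: "RV \<in> measurable M K"
  using standing by (simp add: standing_assumptions_def)

lemma indep: "indep_vars (\<lambda>_. borel) X {1..N}"
  using standing by (simp add: standing_assumptions_def)

lemma ab: "k \<in> {1..N} \<Longrightarrow> a k < b k"
  using standing by (simp add: standing_assumptions_def)

lemma n_pos: "k \<in> {1..N} \<Longrightarrow> 0 < n m k"
  using open_knots_degree[OF knots ab] by (metis gr_zeroI not_less_zero)

lemma spline_input: "k \<in> {1..N} \<Longrightarrow> spline_input M (X k) (f k) (a k) (b k) (p k) (n m k) (\<xi> m k)"
  using standing knots prob_space_axioms
  by (auto simp: standing_assumptions_def spline_input_def spline_input_axioms_def)

abbreviation psi :: "nat \<Rightarrow> nat \<Rightarrow> nat \<Rightarrow> real \<Rightarrow> real" where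
  "psi m k \<equiv> on_bspline M (X k) (p k) (n m k) (\<xi> m k)"

definition indices :: "nat \<Rightarrow> (nat \<Rightarrow> nat) set" where
  "indices m = (\<Pi>\<^sub>E k\<in>{1..N}. {1..n m k})"

definition tensor :: "nat \<Rightarrow> (nat \<Rightarrow> nat) \<Rightarrow> 'a \<Rightarrow> real" where
  "tensor m i \<omega> = (\<Prod>k\<in>{1..N}. psi m k (i k) (X k \<omega>))"

definition tensor_span :: "nat \<Rightarrow> ('a \<Rightarrow> real) set" where
  "tensor_span m = range (\<lambda>d \<omega>. \<Sum>i\<in>indices m. d i * tensor m i \<omega>)"

lemma finite_indices: "finite (indices m)"
  by (simp add: indices_def finite_PiE)

lemma X_measurable [measurable]: "k \<in> {1..N} \<Longrightarrow> X k \<in> borel_measurable M"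
  by (rule spline_input.Y_measurable[OF spline_input])

lemma psi_X_bounded:
  assumes k: "k \<in> {1..N}" and i: "i \<in> {1..n m k}"
  shows "(\<lambda>\<omega>. psi m k i (X k \<omega>)) \<in> borel_measurable M" "\<exists>C. \<forall>\<omega>. \<bar>psi m k i (X k \<omega>)\<bar> \<le> C"
proof -
  note [measurable] = spline_input.on_bspline_measurable[OF spline_input[OF k] i] X_measurable[OF k]
  show "(\<lambda>\<omega>. psi m k i (X k \<omega>)) \<in> borel_measurable M" by measurable
  obtain C where "\<And>x. \<bar>psi m k i x\<bar> \<le> C"
    using spline_input.on_bspline_bounded[OF spline_input[OF k] i] by blast
  then show "\<exists>C. \<forall>\<omega>. \<bar>psi m k i (X k \<omega>)\<bar> \<le> C" by blast
qed

lemma tensor_L2: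
  assumes i: "i \<in> indices m"
  shows "tensor m i \<in> L2"
proof -
  have ik: "i k \<in> {1..n m k}" if "k \<in> {1..N}" for k
    using i that by (auto simp: indices_def PiE_iff)
  have "\<exists>C. \<forall>k\<in>{1..N}. \<forall>\<omega>. \<bar>psi m k (i k) (X k \<omega>)\<bar> \<le> C k"
    by (rule bchoice) (use psi_X_bounded(2) ik in blast)
  then obtain C where C: "\<And>k \<omega>. k \<in> {1..N} \<Longrightarrow> \<bar>psi m k (i k) (X k \<omega>)\<bar> \<le> C k" by blast
  show ?thesis
  proof (rule L2_bounded)
    show "tensor m i \<in> borel_measurable M"
      unfolding tensor_def by (intro borel_measurable_prod psi_X_bounded(1) ik)
    show "AE \<omega> in M. \<bar>tensor m i \<omega>\<bar> \<le> (\<Prod>k\<in>{1..N}. C k)"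
      unfolding tensor_def abs_prod using C by (intro AE_I2 prod_mono) auto
  qed
qed

text \<open>
  By independence the expectation of the product is the product of the one-dimensional expectations.
\<close>

lemma tensor_orthonormal:
  assumes i: "i \<in> indices m" and j: "j \<in> indices m"
  shows "expectation (\<lambda>\<omega>. tensor m i \<omega> * tensor m j \<omega>) = of_bool (i = j)"
proof -
  have ik: "i k \<in> {1..n m k}" "j k \<in> {1..n m k}" if "k \<in> {1..N}" for k
    using i j that by (auto simp: indices_def PiE_iff)
  let ?h = "\<lambda>k x. psi m k (i k) x * psi m k (j k) x"
  have h: "?h k \<in> borel_measurable borel" if k: "k \<in> {1..N}" for k
    by (intro borel_measurable_times spline_input.on_bspline_measurable[OF spline_input[OF k]] ik k)
  have "expectation (\<lambda>\<omega>. tensor m i \<omega> * tensor m j \<omega>) = expectation (\<lambda>\<omega>. \<Prod>k\<in>{1..N}. ?h k (X k \<omega>))"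
    by (simp add: tensor_def prod.distrib)
  also have "\<dots> = (\<Prod>k\<in>{1..N}. expectation (\<lambda>\<omega>. ?h k (X k \<omega>)))"
  proof (rule indep_vars_lebesgue_integral)
    show "indep_vars (\<lambda>_. borel) (\<lambda>k \<omega>. ?h k (X k \<omega>)) {1..N}"
      by (rule indep_vars_compose2[OF indep h])
    fix k assume k: "k \<in> {1..N}"
    have "(\<lambda>\<omega>. psi m k (i k) (X k \<omega>)) \<in> L2" "(\<lambda>\<omega>. psi m k (j k) (X k \<omega>)) \<in> L2"
      using psi_X_bounded[OF k ik(1)[OF k]] psi_X_bounded[OF k ik(2)[OF k]] by (auto intro: L2_bounded AE_I2)
    then show "integrable M (\<lambda>\<omega>. ?h k (X k \<omega>))" by (rule L2_mult_integrable)
  qed simp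
  also have "\<dots> = (\<Prod>k\<in>{1..N}. of_bool (i k = j k))"
    by (intro prod.cong refl spline_input.on_bspline_orthonormal[OF spline_input] ik)
  also have "\<dots> = of_bool (i = j)"
  proof (cases "i = j")
    case False
    then obtain k where "k \<in> {1..N}" "i k \<noteq> j k"
      using i j unfolding indices_def by (metis PiE_ext)
    then show ?thesis using False by (auto simp: prod_zero_iff)
  qed simp
  finally show ?thesis .
qed

lemma tensor_span_L2: "tensor_span m \<subseteq> L2"
  unfolding tensor_span_def using finite_indices tensor_L2 by (auto intro!: L2_sum L2_scale)

lemma tensor_span_add: "s \<in> tensor_span m \<Longrightarrow> t \<in> tensor_span m \<Longrightarrow> (\<lambda>\<omega>. s \<omega> + t \<omega>) \<in> tensor_span m"
  unfolding tensor_span_def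
proof (elim rangeE)
  fix d e assume "s = (\<lambda>\<omega>. \<Sum>i\<in>indices m. d i * tensor m i \<omega>)" "t = (\<lambda>\<omega>. \<Sum>i\<in>indices m. e i * tensor m i \<omega>)"
  then show "(\<lambda>\<omega>. s \<omega> + t \<omega>) \<in> range (\<lambda>d \<omega>. \<Sum>i\<in>indices m. d i * tensor m i \<omega>)"
    by (intro range_eqI[of _ _ "\<lambda>i. d i + e i"]) (simp add: distrib_right sum.distrib)
qed

lemma tensor_span_scale: "s \<in> tensor_span m \<Longrightarrow> (\<lambda>\<omega>. c * s \<omega>) \<in> tensor_span m"
  unfolding tensor_span_def
proof (elim rangeE)
  fix d assume "s = (\<lambda>\<omega>. \<Sum>i\<in>indices m. d i * tensor m i \<omega>)"
  then show "(\<lambda>\<omega>. c * s \<omega>) \<in> range (\<lambda>d \<omega>. \<Sum>i\<in>indices m. d i * tensor m i \<omega>)"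
    by (intro range_eqI[of _ _ "\<lambda>i. c * d i"]) (simp add: sum_distrib_left mult.assoc)
qed

lemma one_in_tensor_span: "(\<lambda>\<omega>. 1) \<in> tensor_span m"
proof -
  define j where "j = (\<lambda>k\<in>{1..N}. 1 :: nat)"
  have j: "j \<in> indices m" using n_pos by (auto simp: indices_def j_def Suc_le_eq)
  have t: "tensor m j \<omega> = 1" for \<omega>
    unfolding tensor_def by (rule prod.neutral) (use spline_input.on_bspline_1[OF spline_input] in \<open>auto simp: j_def\<close>)
  have "(\<Sum>i\<in>indices m. of_bool (i = j) * tensor m i \<omega>) = 1" for \<omega>
  proof -
    have "(\<Sum>i\<in>indices m. of_bool (i = j) * tensor m i \<omega>) = (\<Sum>i\<in>indices m. if i = j then 1 else 0)"
      by (rule sum.cong) (auto simp: t)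
    then show ?thesis using j by (simp add: finite_indices)
  qed
  then show ?thesis unfolding tensor_span_def by (intro range_eqI[of _ _ "\<lambda>i. of_bool (i = j)"]) simp
qed

text \<open>
  Directions outside \<open>u\<close> may be filled up with \<open>\<psi> 1 = 1\<close>.
\<close>

lemma multi_spline_eq_tensor:
  assumes u: "u \<subseteq> {1..N}" and i: "i \<in> (\<Pi>\<^sub>E k\<in>u. {2..n m k})"
  shows "multi_spline M X p (n m) (\<xi> m) u i (RV \<omega>) = tensor m (\<lambda>k\<in>{1..N}. if k \<in> u then i k else 1) \<omega>"
proof -
  have "tensor m (\<lambda>k\<in>{1..N}. if k \<in> u then i k else 1) \<omega> =
      (\<Prod>k\<in>{1..N}. if k \<in> u then psi m k (i k) (X k \<omega>) else 1)"
    unfolding tensor_def by (rule prod.cong) (use spline_input.on_bspline_1[OF spline_input] in auto)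
  also have "\<dots> = (\<Prod>k\<in>u. psi m k (i k) (X k \<omega>))"
    using u by (simp add: prod.inter_restrict[symmetric] Int_absorb1)
  also have "\<dots> = multi_spline M X p (n m) (\<xi> m) u i (RV \<omega>)"
    unfolding multi_spline_def by (rule prod.cong) (use u in \<open>auto simp: random_vec_def\<close>)
  finally show ?thesis by simp
qed

text \<open>
  The pairs of a set \<open>u\<close> and indices at least \<open>2\<close> on \<open>u\<close> correspond to the multi-indices over all
  directions, \<open>u\<close> being the set of directions with an index other than \<open>1\<close>. The mean of \<open>y\<close> is the
  term of the empty set.
\<close>

lemma sdd_eq_projection:
  "sdd M N X p (n m) (\<xi> m) y (RV \<omega>)
     = (\<Sum>i\<in>indices m. expectation (\<lambda>\<omega>. y (RV \<omega>) * tensor m i \<omega>) * tensor m i \<omega>)"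
proof -
  let ?I = "\<lambda>u. (\<Pi>\<^sub>E k\<in>u. {2..n m k})"
  let ?t = "\<lambda>u i. sdd_coeff M N X p (n m) (\<xi> m) y u i * multi_spline M X p (n m) (\<xi> m) u i (RV \<omega>)"
  let ?g = "\<lambda>i. expectation (\<lambda>\<omega>. y (RV \<omega>) * tensor m i \<omega>) * tensor m i \<omega>"
  have empty: "(\<Sum>i \<in> ?I {}. ?t {} i) = (\<integral>\<omega>. y (RV \<omega>) \<partial>M)"
    by (simp add: sdd_coeff_def multi_spline_def)
  have "sdd M N X p (n m) (\<xi> m) y (RV \<omega>) = (\<Sum>u\<in>Pow {1..N}. \<Sum>i \<in> ?I u. ?t u i)"
    unfolding sdd_def using empty by (subst sum.remove[of "Pow {1..N}" "{}"]) auto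
  also have "\<dots> = (\<Sum>(u, i)\<in>(SIGMA u:Pow {1..N}. ?I u). ?t u i)"
    by (rule sum.Sigma) (auto intro!: finite_PiE dest: finite_subset[OF _ finite_atLeastAtMost])
  also have "\<dots> = (\<Sum>i\<in>indices m. ?g i)"
  proof (rule sum.reindex_bij_witness[of _ "\<lambda>i. ({k\<in>{1..N}. i k \<noteq> 1}, restrict i {k\<in>{1..N}. i k \<noteq> 1})"
        "\<lambda>(u, i). \<lambda>k\<in>{1..N}. if k \<in> u then i k else 1"])
    fix v assume v: "v \<in> (SIGMA u:Pow {1..N}. ?I u)"
    obtain u i where ui: "v = (u, i)" "u \<subseteq> {1..N}" "i \<in> ?I u" using v by auto
    let ?j = "\<lambda>k\<in>{1..N}. if k \<in> u then i k else 1"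
    have mem: "2 \<le> i k" "i k \<le> n m k" if "k \<in> u" for k
      using PiE_mem[OF ui(3) that] by auto
    then have gt: "i k \<noteq> 1" "i k \<in> {1..n m k}" if "k \<in> u" for k
      using mem[OF that] by auto
    have set: "{k\<in>{1..N}. ?j k \<noteq> 1} = u" using gt ui(2) by auto
    have "restrict ?j u = i"
    proof (rule ext)
      fix k show "restrict ?j u k = i k"
        using ui(2,3) by (cases "k \<in> u") (auto simp: PiE_iff extensional_def)
    qed
    then show "(\<lambda>i. ({k\<in>{1..N}. i k \<noteq> 1}, restrict i {k\<in>{1..N}. i k \<noteq> 1})) ((\<lambda>(u, i). \<lambda>k\<in>{1..N}. if k \<in> u then i k else 1) v) = v"
      using set ui(1) by simp
    show "(\<lambda>(u, i). \<lambda>k\<in>{1..N}. if k \<in> u then i k else 1) v \<in> indices m"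
      using gt n_pos by (auto simp: ui(1) indices_def Suc_le_eq)
    show "?g ((\<lambda>(u, i). \<lambda>k\<in>{1..N}. if k \<in> u then i k else 1) v) = (case v of (u, i) \<Rightarrow> ?t u i)"
      using multi_spline_eq_tensor[OF ui(2,3)] ui(1) by (simp add: sdd_coeff_def)
  next
    fix i assume i: "i \<in> indices m"
    let ?u = "{k\<in>{1..N}. i k \<noteq> 1}"
    show "(\<lambda>(u, i). \<lambda>k\<in>{1..N}. if k \<in> u then i k else 1) (?u, restrict i ?u) = i"
      using i by (auto simp: indices_def PiE_iff extensional_def)
    show "(?u, restrict i ?u) \<in> (SIGMA u:Pow {1..N}. ?I u)"
    proof (rule SigmaI)
      show "restrict i ?u \<in> ?I ?u"
      proof (rule restrict_PiE_iff[THEN iffD2], rule ballI)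
        fix k assume k: "k \<in> ?u"
        then have "i k \<in> {1..n m k}" using i by (auto simp: indices_def PiE_iff)
        then show "i k \<in> {2..n m k}" using k by auto
      qed
    qed auto
  qed
  finally show ?thesis .
qed

lemma sdd_in_tensor_span: "(\<lambda>\<omega>. sdd M N X p (n m) (\<xi> m) y (RV \<omega>)) \<in> tensor_span m"
  unfolding sdd_eq_projection tensor_span_def by (rule rangeI)

lemma sdd_best_approximation:
  assumes y: "(\<lambda>\<omega>. y (RV \<omega>)) \<in> L2" and s: "s \<in> tensor_span m"
  shows "expectation (\<lambda>\<omega>. (y (RV \<omega>) - sdd M N X p (n m) (\<xi> m) y (RV \<omega>))\<^sup>2)
    \<le> expectation (\<lambda>\<omega>. (y (RV \<omega>) - s \<omega>)\<^sup>2)"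
proof -
  obtain d where "s = (\<lambda>\<omega>. \<Sum>i\<in>indices m. d i * tensor m i \<omega>)" using s by (auto simp: tensor_span_def)
  then show ?thesis unfolding sdd_eq_projection
    using orthogonal_projection_optimal[OF finite_indices tensor_L2 tensor_orthonormal y] by simp
qed

lemma spline_product_in_tensor_span:
  obtains s where "s \<in> tensor_span m"
    "AE \<omega> in M. s \<omega> = (\<Prod>k\<in>{1..N}. spline_step (p k) (n m k) (\<xi> m k) (c k) (X k \<omega>))"
proof -
  have "\<exists>e. \<forall>k\<in>{1..N}. \<forall>x\<in>{a k..<b k}. spline_step (p k) (n m k) (\<xi> m k) (c k) x = (\<Sum>i = 1..n m k. e k i * psi m k i x)"
  proof (rule bchoice, rule ballI)
    fix k assume k: "k \<in> {1..N}"
    obtain e where "\<And>x. x \<in> {a k..<b k} \<Longrightarrow>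
      (\<Sum>i = 1..n m k. of_bool (\<xi> m k i \<le> c k) * bspline (\<xi> m k) (p k) i x) = (\<Sum>i = 1..n m k. e i * psi m k i x)"
      by (rule spline_input.spline_on_bspline_expansion[OF spline_input[OF k, of m], of "\<lambda>i. of_bool (\<xi> m k i \<le> c k)"]) blast
    then show "\<exists>e. \<forall>x\<in>{a k..<b k}. spline_step (p k) (n m k) (\<xi> m k) (c k) x = (\<Sum>i = 1..n m k. e i * psi m k i x)"
      unfolding spline_step_def by blast
  qed
  then obtain e where e: "\<And>k x. k \<in> {1..N} \<Longrightarrow> x \<in> {a k..<b k} \<Longrightarrow>
    spline_step (p k) (n m k) (\<xi> m k) (c k) x = (\<Sum>i = 1..n m k. e k i * psi m k i x)" by blast
  let ?s = "\<lambda>\<omega>. \<Sum>i\<in>indices m. (\<Prod>k\<in>{1..N}. e k (i k)) * tensor m i \<omega>"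
  have prod: "?s \<omega> = (\<Prod>k\<in>{1..N}. \<Sum>i = 1..n m k. e k i * psi m k i (X k \<omega>))" for \<omega>
    by (subst prod_sum_PiE) (auto simp: indices_def tensor_def prod.distrib)
  show thesis
  proof (rule that)
    show "?s \<in> tensor_span m" unfolding tensor_span_def
      by (rule range_eqI[of _ _ "\<lambda>i. \<Prod>k\<in>{1..N}. e k (i k)"]) simp
    have "AE \<omega> in M. \<forall>k\<in>{1..N}. X k \<omega> \<in> {a k..<b k}"
      by (rule AE_finite_allI[OF finite_atLeastAtMost]) (rule spline_input.AE_Y_range[OF spline_input])
    then show "AE \<omega> in M. ?s \<omega> = (\<Prod>k\<in>{1..N}. spline_step (p k) (n m k) (\<xi> m k) (c k) (X k \<omega>))"
      unfolding prod by eventually_elim (intro prod.cong refl, simp add: e)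
  qed
qed

text \<open>
  The product of the step splines is bounded by one and, almost surely, equal to the indicator of the
  box for all fine meshes, because \<open>X\<^sub>k\<close> hits the jump \<open>c\<^sub>k\<close> with probability zero.
\<close>

lemma approximable_lower_box:
  "approximable tensor_span (\<lambda>\<omega>. \<Prod>k\<in>{1..N}. of_bool (X k \<omega> \<le> c k))" (is "approximable _ ?g")
proof -
  let ?S = "\<lambda>m \<omega>. \<Prod>k\<in>{1..N}. spline_step (p k) (n m k) (\<xi> m k) (c k) (X k \<omega>)"
  have step_meas: "spline_step (p k) (n m k) (\<xi> m k) (c k) \<in> borel_measurable borel" for k m
    unfolding spline_step_def by (intro borel_measurable_sum borel_measurable_times bspline_measurable) simp
  have S_meas [measurable]: "?S m \<in> borel_measurable M" for m
    by (intro borel_measurable_prod measurable_compose[OF X_measurable step_meas])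
  have "(\<lambda>x. of_bool (x \<le> t) :: real) = indicator {..t}" for t :: real
    by (auto simp: indicator_def)
  then have ind_meas: "(\<lambda>x. of_bool (x \<le> t) :: real) \<in> borel_measurable borel" for t :: real
    by simp
  have g_meas [measurable]: "?g \<in> borel_measurable M"
    by (intro borel_measurable_prod measurable_compose[OF X_measurable ind_meas])
  have g_bounds: "0 \<le> ?g \<omega>" "?g \<omega> \<le> 1" for \<omega> by (auto intro!: prod_nonneg prod_le_1)
  have range: "AE \<omega> in M. \<forall>k\<in>{1..N}. X k \<omega> \<in> {a k..<b k}"
    by (rule AE_finite_allI[OF finite_atLeastAtMost]) (rule spline_input.AE_Y_range[OF spline_input])
  have neq: "AE \<omega> in M. \<forall>k\<in>{1..N}. X k \<omega> \<noteq> c k"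
    by (rule AE_finite_allI[OF finite_atLeastAtMost]) (rule spline_input.AE_Y_neq[OF spline_input])
  have "(\<lambda>m. expectation (\<lambda>\<omega>. (?g \<omega> - ?S m \<omega>)\<^sup>2)) \<longlonglongrightarrow> expectation (\<lambda>\<omega>. 0)"
  proof (rule integral_dominated_convergence[where w = "\<lambda>_. 1"])
    show "AE \<omega> in M. norm ((?g \<omega> - ?S m \<omega>)\<^sup>2) \<le> 1" for m
      using range
    proof eventually_elim
      case (elim \<omega>)
      have bounds: "0 \<le> spline_step (p k) (n m k) (\<xi> m k) (c k) (X k \<omega>) \<and>
          spline_step (p k) (n m k) (\<xi> m k) (c k) (X k \<omega>) \<le> 1" if k: "k \<in> {1..N}" for k
        using spline_step_bounds[OF knots[OF k] ab[OF k] bspec[OF elim k]] by (intro conjI)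
      have "0 \<le> ?S m \<omega>" by (rule prod_nonneg) (use bounds in blast)
      moreover have "?S m \<omega> \<le> 1" by (rule prod_le_1) (use bounds in blast)
      ultimately have "\<bar>?g \<omega> - ?S m \<omega>\<bar> \<le> 1" using g_bounds[of \<omega>] by linarith
      then show ?case by (simp add: abs_square_le_1)
    qed
    show "AE \<omega> in M. (\<lambda>m. (?g \<omega> - ?S m \<omega>)\<^sup>2) \<longlonglongrightarrow> 0"
      using range neq
    proof eventually_elim
      case (elim \<omega>)
      have "(\<lambda>m. spline_step (p k) (n m k) (\<xi> m k) (c k) (X k \<omega>)) \<longlonglongrightarrow> of_bool (X k \<omega> \<le> c k)"
        if k: "k \<in> {1..N}" for k
      proof (rule tendsto_eventually)
        have "(\<lambda>m. (p k + 1) * largest_element (p k) (n m k) (\<xi> m k)) \<longlonglongrightarrow> real (p k + 1) * 0"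
          by (intro tendsto_mult tendsto_const mesh k)
        then have "\<forall>\<^sub>F m in sequentially. real (p k + 1) * largest_element (p k) (n m k) (\<xi> m k) < \<bar>X k \<omega> - c k\<bar>"
          by (rule order_tendstoD(2)) (use bspec[OF elim(2) k] in simp)
        then show "\<forall>\<^sub>F m in sequentially. spline_step (p k) (n m k) (\<xi> m k) (c k) (X k \<omega>) = of_bool (X k \<omega> \<le> c k)"
          by eventually_elim (rule spline_step_eq[OF knots[OF k] ab[OF k] bspec[OF elim(1) k]])
      qed
      then have "(\<lambda>m. ?S m \<omega>) \<longlonglongrightarrow> ?g \<omega>" by (intro tendsto_prod) auto
      then have "(\<lambda>m. (?g \<omega> - ?S m \<omega>)\<^sup>2) \<longlonglongrightarrow> (?g \<omega> - ?g \<omega>)\<^sup>2"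
        by (intro tendsto_power tendsto_diff tendsto_const)
      then show ?case by simp
    qed
    show "(\<lambda>\<omega>. (?g \<omega> - ?S m \<omega>)\<^sup>2) \<in> borel_measurable M" for m
      by (intro borel_measurable_power borel_measurable_diff g_meas S_meas)
  qed simp_all
  then have lim: "(\<lambda>m. expectation (\<lambda>\<omega>. (?g \<omega> - ?S m \<omega>)\<^sup>2)) \<longlonglongrightarrow> 0" by simp
  show ?thesis unfolding approximable_def
  proof (intro conjI allI impI)
    have "\<bar>?g \<omega>\<bar> \<le> 1" for \<omega> using g_bounds[of \<omega>] by simp
    then show "?g \<in> L2" by (intro L2_bounded[OF g_meas] AE_I2)
    fix \<epsilon> :: real assume "\<epsilon> > 0"
    then have "\<forall>\<^sub>F m in sequentially. expectation (\<lambda>\<omega>. (?g \<omega> - ?S m \<omega>)\<^sup>2) < \<epsilon>"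
      using lim by (intro order_tendstoD(2))
    then show "\<forall>\<^sub>F m in sequentially. \<exists>s\<in>tensor_span m. expectation (\<lambda>\<omega>. (?g \<omega> - s \<omega>)\<^sup>2) < \<epsilon>"
    proof eventually_elim
      case (elim m)
      obtain s where s: "s \<in> tensor_span m" "AE \<omega> in M. s \<omega> = ?S m \<omega>"
        using spline_product_in_tensor_span[of m c] by blast
      have [measurable]: "s \<in> borel_measurable M" using s(1) tensor_span_L2 L2_measurable by blast
      have "expectation (\<lambda>\<omega>. (?g \<omega> - s \<omega>)\<^sup>2) = expectation (\<lambda>\<omega>. (?g \<omega> - ?S m \<omega>)\<^sup>2)"
        by (rule integral_cong_AE) (use s(2) in \<open>measurable, auto\<close>)
      then have "expectation (\<lambda>\<omega>. (?g \<omega> - s \<omega>)\<^sup>2) < \<epsilon>" using elim by (simp only:)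
      then show ?case using s(1) by (rule bexI)
    qed
  qed
qed

end

section \<open>Density of the splines and convergence\<close>

context spline_family
begin

lemma approximable_one: "approximable tensor_span (\<lambda>\<omega>. 1)"
  unfolding approximable_def
proof (intro conjI allI impI always_eventually)
  show "(\<lambda>\<omega>. 1) \<in> L2" by (rule L2_bounded[where C = 1]) auto
  fix \<epsilon> :: real and m assume "\<epsilon> > 0"
  then show "\<exists>s\<in>tensor_span m. expectation (\<lambda>\<omega>. (1 - s \<omega>)\<^sup>2) < \<epsilon>"
    by (intro bexI[OF _ one_in_tensor_span]) simp
qed

lemma approximable_sum:
  assumes "finite J" "\<And>j. j \<in> J \<Longrightarrow> approximable tensor_span (g j)"
  shows "approximable tensor_span (\<lambda>\<omega>. \<Sum>j\<in>J. g j \<omega>)"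
  using assms
proof (induction J)
  case empty
  have "approximable tensor_span (\<lambda>\<omega>. 0 * 1)"
    by (rule approximable_scale[OF tensor_span_scale approximable_one])
  then show ?case by simp
next
  case (insert j J)
  have "approximable tensor_span (\<lambda>\<omega>. g j \<omega> + (\<Sum>i\<in>J. g i \<omega>))"
    by (rule approximable_add[OF tensor_span_L2 tensor_span_add]) (use insert in simp_all)
  then show ?case using insert by simp
qed

text \<open>
  Dynkin's \<open>\<pi>\<close>-\<open>\<lambda>\<close> theorem: the sets with an approximable indicator contain the generating boxes and are
  closed under complements (by linearity) and countable disjoint unions (by closedness).
\<close>

lemma approximable_indicator:
  assumes A: "A \<in> sets K"
  shows "approximable tensor_span (\<lambda>\<omega>. indicator A (RV \<omega>))"
proof -
  have sub: "lower_boxes N a b \<subseteq> Pow (space K)" by (auto simp: lower_boxes_def)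
  have sets: "sets K = sigma_sets (space K) (lower_boxes N a b)"
  proof
    have "lower_boxes N a b \<subseteq> sets K"
    proof
      fix B assume "B \<in> lower_boxes N a b"
      then obtain c where B: "B = {x \<in> space K. \<forall>k\<in>{1..N}. x k \<le> c k}" by (auto simp: lower_boxes_def)
      have [measurable]: "(\<lambda>x. x k) \<in> borel_measurable K" if "k \<in> {1..N}" for k
      proof -
        have "(\<lambda>x. x k) \<in> measurable K (restrict_space borel {a k..b k})"
          unfolding input_space_def by (rule measurable_component_singleton[OF that])
        then show ?thesis by (simp add: measurable_restrict_space2_iff)
      qed
      show "B \<in> sets K" unfolding B by measurable
    qed
    then show "sigma_sets (space K) (lower_boxes N a b) \<subseteq> sets K" by (rule sets.sigma_sets_subset)
  qed (rule sets_input_space_le_lower_boxes)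
  have RV_space: "RV \<omega> \<in> space K" if "\<omega> \<in> space M" for \<omega>
    using that measurable_space[OF random_vec_measurable] by blast
  have meas: "(\<lambda>\<omega>. indicator B (RV \<omega>) :: real) \<in> borel_measurable M"
    if "B \<in> sigma_sets (space K) (lower_boxes N a b)" for B
    using that unfolding sets[symmetric]
    by (intro measurable_compose[OF random_vec_measurable] borel_measurable_indicator)
  have "A \<in> sigma_sets (space K) (lower_boxes N a b)" using A sets by simp
  with Int_stable_lower_boxes sub show ?thesis
  proof (induction rule: sigma_sets_induct_disjoint)
    case (basic B)
    then obtain c where B: "B = {x \<in> space K. \<forall>k\<in>{1..N}. x k \<le> c k}" by (auto simp: lower_boxes_def)
    have "indicator B (RV \<omega>) = (\<Prod>k\<in>{1..N}. of_bool (X k \<omega> \<le> c k) :: real)" if "\<omega> \<in> space M" for \<omega>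
    proof (cases "\<forall>k\<in>{1..N}. X k \<omega> \<le> c k")
      case True
      then show ?thesis using RV_space[OF that] by (simp add: B random_vec_def)
    next
      case False
      then have "(\<Prod>k\<in>{1..N}. of_bool (X k \<omega> \<le> c k) :: real) = 0" by (auto simp: prod_zero_iff)
      moreover have "RV \<omega> \<notin> B" using False by (auto simp: B random_vec_def)
      ultimately show ?thesis by simp
    qed
    then show ?case by (rule approximable_cong[THEN iffD2, OF _ approximable_lower_box])
  next
    case empty
    then show ?case using approximable_sum[of "{}"] by simp
  next
    case (compl B)
    have "approximable tensor_span (\<lambda>\<omega>. 1 + (- 1) * indicator B (RV \<omega>))"
      by (intro approximable_add[OF tensor_span_L2 tensor_span_add] approximable_one
          approximable_scale[OF tensor_span_scale] compl)
    then show ?case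
      by (rule approximable_cong[THEN iffD1, rotated]) (use RV_space in \<open>auto simp: indicator_def\<close>)
  next
    case (union B)
    show ?case
    proof (rule approximable_pointwise_limit[OF tensor_span_L2, where h = "\<lambda>j \<omega>. \<Sum>i<j. indicator (B i) (RV \<omega>)" and w = "\<lambda>_. 1"])
      show "(\<lambda>\<omega>. indicator (\<Union> (range B)) (RV \<omega>) :: real) \<in> borel_measurable M"
        by (rule meas) (use union(2) in \<open>auto intro: sigma_sets.Union\<close>)
      show "approximable tensor_span (\<lambda>\<omega>. \<Sum>i<j. indicator (B i) (RV \<omega>))" for j
        by (rule approximable_sum) (use union in auto)
      show "(\<lambda>_. 1) \<in> L2" using approximable_one by (simp add: approximable_def)
      have part: "(\<Sum>i<j. indicator (B i) x) = (indicator (\<Union>i<j. B i) x :: real)" for j x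
        using union(1) by (subst indicator_UN_disjoint) (auto simp: disjoint_family_on_def)
      show "\<bar>indicator (\<Union> (range B)) (RV \<omega>) - (\<Sum>i<j. indicator (B i) (RV \<omega>))\<bar> \<le> \<bar>1 :: real\<bar>" for j \<omega>
        unfolding part by (auto simp: indicator_def)
      show "(\<lambda>j. \<Sum>i<j. indicator (B i) (RV \<omega>)) \<longlonglongrightarrow> (indicator (\<Union> (range B)) (RV \<omega>) :: real)" for \<omega>
        unfolding part by (rule LIMSEQ_indicator_UN)
    qed
  qed
qed

lemma approximable_L2:
  assumes y: "y \<in> borel_measurable K" and yL: "(\<lambda>\<omega>. y (RV \<omega>)) \<in> L2"
  shows "approximable tensor_span (\<lambda>\<omega>. y (RV \<omega>))"
proof -
  have RV_space: "RV \<omega> \<in> space K" if "\<omega> \<in> space M" for \<omega>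
    using that measurable_space[OF random_vec_measurable] by blast
  obtain F where F: "\<And>i. simple_function K (F i)" "\<And>x. x \<in> space K \<Longrightarrow> (\<lambda>i. F i x) \<longlonglongrightarrow> y x"
    "\<And>i x. x \<in> space K \<Longrightarrow> dist (F i x) 0 \<le> 2 * dist (y x) 0"
    using borel_measurable_implies_sequence_metric[OF y, of 0] by blast
  show ?thesis
  \<comment> \<open>The simple functions satisfy \<open>|F i| \<le> 2 |y|\<close>, whence the bound \<open>3 |y|\<close> for the differences.\<close>
  proof (rule approximable_pointwise_limit[OF tensor_span_L2, where h = "\<lambda>i \<omega>. F i (RV \<omega>)" and w = "\<lambda>\<omega>. 3 * y (RV \<omega>)"])
    show "(\<lambda>\<omega>. y (RV \<omega>)) \<in> borel_measurable M" by (rule L2_measurable[OF yL])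
    show "(\<lambda>\<omega>. 3 * y (RV \<omega>)) \<in> L2" by (rule L2_scale[OF yL])
    show "(\<lambda>i. F i (RV \<omega>)) \<longlonglongrightarrow> y (RV \<omega>)" if "\<omega> \<in> space M" for \<omega> by (rule F(2)[OF RV_space[OF that]])
    show "\<bar>y (RV \<omega>) - F i (RV \<omega>)\<bar> \<le> \<bar>3 * y (RV \<omega>)\<bar>" if "\<omega> \<in> space M" for i \<omega>
      using F(3)[OF RV_space[OF that], of i] by (auto simp: abs_mult)
    fix i
    have "approximable tensor_span (\<lambda>\<omega>. \<Sum>v\<in>F i ` space K. v * indicator (F i -` {v} \<inter> space K) (RV \<omega>))"
    proof (rule approximable_sum)
      show "finite (F i ` space K)" using F(1) by (simp add: simple_function_def)
      fix v assume "v \<in> F i ` space K"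
      then have "F i -` {v} \<inter> space K \<in> sets K" using F(1) by (auto simp: simple_function_def)
      then show "approximable tensor_span (\<lambda>\<omega>. v * indicator (F i -` {v} \<inter> space K) (RV \<omega>))"
        by (intro approximable_scale[OF tensor_span_scale] approximable_indicator)
    qed
    moreover have "(\<Sum>v\<in>F i ` space K. v * indicator (F i -` {v} \<inter> space K) (RV \<omega>)) = F i (RV \<omega>)"
      if "\<omega> \<in> space M" for \<omega>
    proof -
      have "(\<Sum>v\<in>F i ` space K. v * indicator (F i -` {v} \<inter> space K) (RV \<omega>))
        = (\<Sum>v\<in>F i ` space K. if v = F i (RV \<omega>) then v else 0)"
        by (rule sum.cong) (use RV_space[OF that] in \<open>auto simp: indicator_def\<close>)
      then show ?thesis using F(1)[of i] RV_space[OF that] by (simp add: simple_function_def)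
    qed
    ultimately show "approximable tensor_span (\<lambda>\<omega>. F i (RV \<omega>))"
      by (rule approximable_cong[THEN iffD1, rotated])
  qed
qed

lemma sdd_mean_square_convergence:
  assumes y: "y \<in> borel_measurable K" and yL: "(\<lambda>\<omega>. y (RV \<omega>)) \<in> L2"
  shows "(\<lambda>m. expectation (\<lambda>\<omega>. (y (RV \<omega>) - sdd M N X p (n m) (\<xi> m) y (RV \<omega>))\<^sup>2)) \<longlonglongrightarrow> 0"
proof (rule LIMSEQ_I)
  let ?e = "\<lambda>m. expectation (\<lambda>\<omega>. (y (RV \<omega>) - sdd M N X p (n m) (\<xi> m) y (RV \<omega>))\<^sup>2)"
  fix r :: real assume "r > 0"
  then have "\<forall>\<^sub>F m in sequentially. \<exists>s\<in>tensor_span m. expectation (\<lambda>\<omega>. (y (RV \<omega>) - s \<omega>)\<^sup>2) < r"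
    by (rule approximableD[OF approximable_L2[OF y yL]])
  then have "\<forall>\<^sub>F m in sequentially. norm (?e m - 0) < r"
  proof eventually_elim
    case (elim m)
    then have "?e m < r" using sdd_best_approximation[OF yL] by (meson le_less_trans)
    moreover have "0 \<le> ?e m" by simp
    ultimately show ?case by simp
  qed
  then show "\<exists>m0. \<forall>m\<ge>m0. norm (?e m - 0) < r" by (simp add: eventually_sequentially)
qed

end

theorem proposition5p7:
  fixes M :: "'a measure" and N :: nat and a b :: "nat \<Rightarrow> real"
    and X :: "nat \<Rightarrow> 'a \<Rightarrow> real" and f :: "nat \<Rightarrow> real \<Rightarrow> real"
    and p :: "nat \<Rightarrow> nat" and y :: "(nat \<Rightarrow> real) \<Rightarrow> real"
    and n :: "nat \<Rightarrow> nat \<Rightarrow> nat" and \<xi> :: "nat \<Rightarrow> nat \<Rightarrow> nat \<Rightarrow> real"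
  assumes "standing_assumptions M N a b X f"
    and "y \<in> borel_measurable (input_space N a b)"
    and "integrable M (\<lambda>\<omega>. (y (random_vec N X \<omega>))\<^sup>2)"
    and "\<And>m k. k \<in> {1..N} \<Longrightarrow> open_knots (a k) (b k) (p k) (n m k) (\<xi> m k)"
    and "\<And>k. k \<in> {1..N} \<Longrightarrow> (\<lambda>m. largest_element (p k) (n m k) (\<xi> m k)) \<longlonglongrightarrow> 0"
  shows
    "(\<lambda>m. \<integral>\<omega>. \<bar>y (random_vec N X \<omega>) - sdd M N X p (n m) (\<xi> m) y (random_vec N X \<omega>)\<bar>\<^sup>2 \<partial>M)
       \<longlonglongrightarrow> 0 \<and>
     (\<forall>\<epsilon>>0. (\<lambda>m. measure M {\<omega> \<in> space M.
        \<bar>y (random_vec N X \<omega>) - sdd M N X p (n m) (\<xi> m) y (random_vec N X \<omega>)\<bar> > \<epsilon>}) \<longlonglongrightarrow> 0) \<and>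
     (let F = (\<lambda>t. measure M {\<omega> \<in> space M. y (random_vec N X \<omega>) \<le> t});
          Fs = (\<lambda>m t. measure M {\<omega> \<in> space M.
                  sdd M N X p (n m) (\<xi> m) y (random_vec N X \<omega>) \<le> t})
      in (\<forall>t::real. isCont F t \<longrightarrow> (\<lambda>m. Fs m t) \<longlonglongrightarrow> F t) \<and>
         (continuous_on UNIV F \<longrightarrow> uniform_limit UNIV Fs F sequentially))"
proof -
  interpret spline_family M N a b X f p n \<xi>
    by (rule spline_family.intro) (rule assms; assumption?)+
  let ?Z = "\<lambda>\<omega>. y (RV \<omega>)" and ?W = "\<lambda>m \<omega>. sdd M N X p (n m) (\<xi> m) y (RV \<omega>)"
  let ?F = "\<lambda>t. prob {\<omega> \<in> space M. ?Z \<omega> \<le> t}"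
  have Z_meas: "?Z \<in> borel_measurable M"
    by (rule measurable_compose[OF random_vec_measurable assms(2)])
  then have Z: "?Z \<in> L2" using assms(3) by (simp add: L2_def)
  have W: "?W m \<in> L2" for m using sdd_in_tensor_span tensor_span_L2 by blast
  have ms: "(\<lambda>m. expectation (\<lambda>\<omega>. (?Z \<omega> - ?W m \<omega>)\<^sup>2)) \<longlonglongrightarrow> 0"
    by (rule sdd_mean_square_convergence[OF assms(2) Z])
  have ip: "(\<lambda>m. prob {\<omega> \<in> space M. \<bar>?Z \<omega> - ?W m \<omega>\<bar> > \<epsilon>}) \<longlonglongrightarrow> 0" if "\<epsilon> > 0" for \<epsilon>
    by (rule mean_square_imp_in_probability[OF L2_diff[OF Z W] ms that])
  have in_distribution: "uniform_limit S (\<lambda>m t. prob {\<omega> \<in> space M. ?W m \<omega> \<le> t}) ?F sequentially"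
    if "\<And>e. e > 0 \<Longrightarrow> \<exists>d>0. \<forall>t \<in> S. \<forall>s. \<bar>s - t\<bar> \<le> d \<longrightarrow> \<bar>?F s - ?F t\<bar> < e" for S
    using Z_meas L2_measurable[OF W] ip that by (rule in_probability_imp_in_distribution)
  have pointwise: "(\<lambda>m. prob {\<omega> \<in> space M. ?W m \<omega> \<le> t}) \<longlonglongrightarrow> ?F t" if cont: "isCont ?F t" for t
  proof -
    have "\<exists>d>0. \<forall>t' \<in> {t}. \<forall>s. \<bar>s - t'\<bar> \<le> d \<longrightarrow> \<bar>?F s - ?F t'\<bar> < e" if e: "e > 0" for e
    proof -
      obtain d where d: "d > 0" "\<And>s. dist s t < d \<Longrightarrow> dist (?F s) (?F t) < e"
        using cont[unfolded continuous_at_eps_delta, rule_format, OF e] by auto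
      show ?thesis
      proof (intro exI[of _ "d / 2"] conjI ballI allI impI)
        fix t' s assume "t' \<in> {t}" "\<bar>s - t'\<bar> \<le> d / 2"
        then have "dist s t < d" "t' = t" using d(1) by (auto simp: dist_real_def)
        then show "\<bar>?F s - ?F t'\<bar> < e" using d(2)[of s] by (simp only: dist_real_def)
      qed (use d(1) in simp)
    qed
    then have "uniform_limit {t} (\<lambda>m t. prob {\<omega> \<in> space M. ?W m \<omega> \<le> t}) ?F sequentially"
      by (rule in_distribution)
    then show ?thesis by (rule tendsto_uniform_limitI) simp
  qed
  have uniform: "uniform_limit UNIV (\<lambda>m t. prob {\<omega> \<in> space M. ?W m \<omega> \<le> t}) ?F sequentially"
    if "continuous_on UNIV ?F"
  proof (rule in_distribution)
    fix e :: real assume "e > 0"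
    from continuous_distribution_function_uniformly_continuous[OF Z_meas that this]
    show "\<exists>d>0. \<forall>t\<in>UNIV. \<forall>s. \<bar>s - t\<bar> \<le> d \<longrightarrow> \<bar>?F s - ?F t\<bar> < e" by simp
  qed
  show ?thesis
    unfolding Let_def power2_abs by (intro conjI allI impI ms ip pointwise uniform)
qed

end
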